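(* Let $\nu\in\mathbb{R}$, $\nu\neq 0$, be fixed, and consider the family, with real parameters $(a,s)\in\mathbb{R}^2$, of differential equations on the torus $\mathbb{T}^2=S^1\times S^1$, $S^1=\mathbb{R}/2\pi\mathbb{Z}$, with coordinates $(x,t)$, $$\frac{dx}{dt}=\nu\sin x+a+s\sin t .$$ Let $\rho(a,s)$ be its rotation number, and for $r\in\mathbb{Z}$ consider the $r$-th Arnold tongue $\{(a,s)\in\mathbb{R}^2 : \rho(a,s)=r\}$ and its adjacencies (defined in the context). Then: 1. If $|\nu|\le 1$, then for every $r\in\mathbb{Z}$ all the adjacencies of the $r$-th Arnold tongue lie on the vertical line $a=r$. 2. For every $\nu\neq 0$, every adjacency of every Arnold tongue has integer abscissa: $a\in\mathbb{Z}$. 3. For every $\nu\neq0$ and every $r\in\mathbb{Z}$, the abscissa $a$ of each adjacency of the $r$-th Arnold tongue has the same sign as $r$, and $|a|\le |r|$. 4. For every $\nu\neq0$, the adjacencies corresponding to zero rotation number ($r=0$) are exactly those adjacencies that lie on the axis $a=0$.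
   Context: The period $2\pi$ flow map of the equation (from $t=0$ to $t=2\pi$) is a circle diffeomorphism $h_{a,s}:S^1\to S^1$. The rotation number $\rho(a,s)\in\mathbb{R}$ is normalized as rotation angle divided by $2\pi$: if $x(t)\in\mathbb{R}$ is any solution of the equation lifted to the real line, then $\rho(a,s)=\lim_{n\to\infty}\frac{x(2\pi n)-x(0)}{2\pi n}$. The $a$-coordinate of a point $(a,s)$ is called its abscissa, the $s$-coordinate its ordinate. For $\nu\ne0$ fixed, the $r$-th Arnold tongue is the level set $\{(a,s)\in\mathbb{R}^2:\rho(a,s)=r\}$, provided it has non-empty interior. It is known that Arnold tongues exist only for integer $r$, and that the boundary of the $r$-th tongue consists of two analytic curves which are graphs $a=g_r^-(s)$ and $a=g_r^+(s)$. For each $s$, the horizontal slice of the tongue is the segment with endpoints $g_r^-(s)$ and $g_r^+(s)$. An adjacency of the $r$-th Arnold tongue is a point $(a,s)$ with $s\neq 0$ at which the two boundary curves meet, i.e. $a=g_r^-(s)=g_r^+(s)$. Equivalently, $s\ne0$ and $a$ is the only real number $a'$ with $\rho(a',s)=r$. (Points with $s=0$ are not counted as adjacencies.) *)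

theory Defs
  imports "HOL-Analysis.Analysis"
begin

text \<open>The equation is used in its lift to the universal cover of the circle, so a solution takes
  values in the reals rather than modulo \<open>2\<pi>\<close>. All solutions are global, since the right-hand side
  is bounded on bounded time intervals.\<close>

definition lifted_solution :: "real \<Rightarrow> real \<Rightarrow> real \<Rightarrow> (real \<Rightarrow> real) \<Rightarrow> bool" where
  "lifted_solution \<nu> a s x \<longleftrightarrow>
     (\<forall>t. (x has_real_derivative (\<nu> * sin (x t) + a + s * sin t)) (at t))"

definition rotation_number :: "real \<Rightarrow> real \<Rightarrow> real \<Rightarrow> real" where
  "rotation_number \<nu> a s =
     (THE \<rho>. \<forall>x. lifted_solution \<nu> a s x \<longrightarrow>
        (\<lambda>n::nat. (x (2 * pi * real n) - x 0) / (2 * pi * real n)) \<longlonglongrightarrow> \<rho>)"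

definition rotation_level_set :: "real \<Rightarrow> real \<Rightarrow> (real \<times> real) set" where
  "rotation_level_set \<nu> r = {(a, s). rotation_number \<nu> a s = r}"

text \<open>The level set is called the \<open>r\<close>-th Arnold tongue only if it has non-empty interior. Real values
  of \<open>r\<close> are allowed here; that only integers occur is a fact about the equation and
  is not built into the definition.\<close>

definition is_arnold_tongue :: "real \<Rightarrow> real \<Rightarrow> bool" where
  "is_arnold_tongue \<nu> r \<longleftrightarrow> interior (rotation_level_set \<nu> r) \<noteq> {}"

text \<open>The boundary curves \<open>a = g\<^sub>r\<^sup>-(s)\<close> and \<open>a = g\<^sub>r\<^sup>+(s)\<close>, given by the left and right
  endpoints of the horizontal slice of the tongue at height \<open>s\<close>.\<close>

definition left_boundary :: "real \<Rightarrow> real \<Rightarrow> real \<Rightarrow> real" where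
  "left_boundary \<nu> r s = Inf {a. (a, s) \<in> rotation_level_set \<nu> r}"

definition right_boundary :: "real \<Rightarrow> real \<Rightarrow> real \<Rightarrow> real" where
  "right_boundary \<nu> r s = Sup {a. (a, s) \<in> rotation_level_set \<nu> r}"

text \<open>Membership in the level set is required explicitly because \<open>Inf\<close> and \<open>Sup\<close> are
  unspecified on an empty slice. It is no restriction: the slices of a tongue are non-empty compact
  segments, so the boundary curves lie in the tongue.\<close>

definition is_adjacency :: "real \<Rightarrow> real \<Rightarrow> real \<times> real \<Rightarrow> bool" where
  "is_adjacency \<nu> r = (\<lambda>(a, s).
     is_arnold_tongue \<nu> r \<and> s \<noteq> 0 \<and> (a, s) \<in> rotation_level_set \<nu> r \<and>
     a = left_boundary \<nu> r s \<and> a = right_boundary \<nu> r s)"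

end

(*
  Write F(t) = a + s sin t. For a solution x, the function cis x is the quotient w / v of a solution of
  the linear system v' = -(nu/2) w, w' = -(nu/2) v + i F w, which preserves |w|^2 - |v|^2.

  Rotation number: by Brouwer, the period map on the closed disc of values w / v has a fixed point. If
  it lies on the circle, the rotation number is an integer. If it lies inside, a Moebius change of
  coordinates conjugates the flow to a rotation, and the rotation number increases strictly in a. So
  tongues exist only for integers r, and at an adjacency the period map is exactly x + 2 pi r.

  Then all solutions of the linear system have the same multiplier exp(2 pi i mu), mu = (a - r) / 2.
  The Fourier coefficients of w, at frequencies in mu + Z, satisfy a three-term recurrence whose
  Casoratian has constant modulus and tends to 0. For mu outside Z the recurrence would leave only a
  one-dimensional space of solutions; hence mu is an integer, and so is a.

  For integer mu the recurrence degenerates at frequency 0, and there is a nonzero solution without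
  negative frequencies. The component of larger modulus, v or w, has no zeros on the circle, and is
  a limit of polynomials in cis t, so its winding number is nonnegative. As v winds mu times and w
  winds mu + r times, a >= r or a + r >= 2. The symmetry (x, t) -> (-x, t + pi) replaces (a, r) by
  (-a, -r) and gives a <= r or a + r <= -2. Together |a| <= |r|. The signs agree by comparison of
  the equation with its reflection. If |nu| <= 1, then |a - r| <= 1 and a - r is even.
*)

theory Submission
  imports
    Defs
    "HOL-Computational_Algebra.Fundamental_Theorem_Algebra"
begin

text \<open>The period map is the boundary action of a Moebius transformation of the closed disc.
  This replaces the general theory of circle maps: a fixed point in the disc yields the existence of
  the rotation number and, if it lies inside, its strict growth in \<open>a\<close>.

  At an adjacency this transformation is the identity, so the monodromy of the linear system is a
  scalar and every solution has the same multiplier. Its square is known from the Wronskian, which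
  determines mu only modulo 1/2; the winding arguments need mu itself, and it comes from integrating
  the scalar equation over one period.

  Two independent solutions are too many for the recurrence: the Fourier coefficients of both decay,
  while its step matrices have determinant -1. The only escape is the division by the frequency made
  when v is eliminated. It fails at frequency 0, which is met exactly when mu is an integer; there
  the coefficient of w vanishes, and the negative and positive frequencies no longer constrain each
  other.\<close>

lemma periodic_shift_int:
  fixes f :: "real \<Rightarrow> 'a"
  assumes "\<And>t. f (t + 2 * pi) = f t"
  shows "f (t + 2 * pi * real_of_int k) = f t"
proof (induction k rule: int_induct[of _ 0])
  case base
  then show ?case by simp
next
  case (step1 i)
  then show ?case using assms[of "t + 2 * pi * real_of_int i"] by (simp add: algebra_simps)
next
  case (step2 i)
  then show ?case using assms[of "t + 2 * pi * real_of_int (i - 1)"] by (simp add: algebra_simps)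
qed

lemma reduce_mod_2pi:
  fixes x c :: real
  obtains k where "x - 2 * pi * real_of_int k \<in> {c..c + 2 * pi}"
proof -
  define k where "k = \<lfloor>(x - c) / (2 * pi)\<rfloor>"
  have "real_of_int k \<le> (x - c) / (2 * pi)" "(x - c) / (2 * pi) \<le> real_of_int k + 1"
    unfolding k_def by linarith+
  then have "x - 2 * pi * real_of_int k \<in> {c..c + 2 * pi}" by (simp add: field_simps)
  then show ?thesis by (rule that)
qed

lemma cis_periodic_int: "cis (t + 2 * pi * real_of_int k) = cis t"
  by (rule periodic_shift_int) (simp add: complex_eq_iff)

section \<open>Solutions and the period map\<close>

lemma continuous_antiderivative:
  fixes f :: "real \<Rightarrow> 'a::banach"
  assumes "continuous_on UNIV f"
  obtains F where "F 0 = 0" and "\<And>t. (F has_vector_derivative f t) (at t)"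
proof -
  \<comment> \<open>A signed integral from 0 to \<open>t\<close>: the integral over a reversed
    interval is 0, so at most one of the two terms survives.\<close>
  define F where "F t = integral {0..t} f - integral {t..0} f" for t
  have int: "f integrable_on {c..d}" for c d
    by (intro integrable_continuous_real continuous_on_subset[OF assms]) auto
  have "(F has_vector_derivative f t) (at t)" for t
  proof -
    define N where "N = \<bar>t\<bar> + 1"
    have eq: "F u = integral {-N..u} f - integral {-N..0} f" if "u \<in> {-N..N}" for u
    proof (cases "u \<ge> 0")
      case True
      then have "integral {-N..0} f + integral {0..u} f = integral {-N..u} f"
        using that by (intro Henstock_Kurzweil_Integration.integral_combine int) auto
      moreover have "integral {u..0} f = 0"
        using True by (cases "u = 0") auto
      ultimately show ?thesis by (simp add: F_def algebra_simps)
    next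
      case False
      then have "integral {-N..u} f + integral {u..0} f = integral {-N..0} f"
        using that by (intro Henstock_Kurzweil_Integration.integral_combine int) auto
      moreover have "integral {0..u} f = 0"
        using False by auto
      ultimately show ?thesis by (simp add: F_def algebra_simps)
    qed
    have "((\<lambda>u. integral {-N..u} f) has_vector_derivative f t) (at t within {-N..N})"
      by (rule integral_has_vector_derivative)
         (auto simp: N_def intro: continuous_on_subset[OF assms])
    then have "((\<lambda>u. integral {-N..u} f - integral {-N..0} f) has_vector_derivative f t)
        (at t within {-N..N})"
      by (auto intro!: derivative_eq_intros)
    then have "(F has_vector_derivative f t) (at t within {-N..N})"
      by (rule has_vector_derivative_transform[rotated -1]) (auto simp: eq N_def)
    moreover have "at t within {-N..N} = at t"
      by (rule at_within_interior) (auto simp: N_def)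
    ultimately show ?thesis by simp
  qed
  moreover have "F 0 = 0" by (simp add: F_def)
  ultimately show ?thesis using that by blast
qed

text \<open>The function \<open>D / L * exp (L * t)\<close> has derivative
  \<open>D * exp (L * t)\<close>, so it outgrows \<open>F\<close>. This is the estimate that bounds
  a Picard step in the weighted norm below.\<close>

lemma has_real_derivative_exp_bound:
  fixes F f :: "real \<Rightarrow> real"
  assumes der: "\<And>t. (F has_real_derivative f t) (at t)" and "F 0 = 0"
    and bound: "\<And>t. \<bar>f t\<bar> \<le> D * exp (L * \<bar>t\<bar>)" and "L > 0"
  shows "\<bar>F t\<bar> \<le> D / L * exp (L * \<bar>t\<bar>)"
proof -
  have D: "D \<ge> 0" using bound[of 0] by (simp add: order_trans[OF abs_ge_zero])
  \<comment> \<open>The one-sided upper bound suffices: it is applied to \<open>F\<close>, to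
    \<open>-F\<close>, and to their reflections in time.\<close>
  have pos: "G t \<le> D / L * exp (L * t)"
    if G: "\<And>t. (G has_real_derivative g t) (at t)" "G 0 = 0"
      "\<And>t. \<bar>g t\<bar> \<le> D * exp (L * \<bar>t\<bar>)" and t: "t \<ge> 0" for G g t
  proof -
    have "D / L * exp (L * 0) - G 0 \<le> D / L * exp (L * t) - G t"
    proof (rule DERIV_nonneg_imp_nondecreasing[OF t])
      fix u assume u: "0 \<le> u" "u \<le> t"
      have "((\<lambda>t. D / L * exp (L * t) - G t) has_real_derivative (D * exp (L * u) - g u)) (at u)"
        using \<open>L > 0\<close> by (auto intro!: derivative_eq_intros G(1))
      moreover have "D * exp (L * u) - g u \<ge> 0" using G(3)[of u] u by auto
      ultimately show "\<exists>y. ((\<lambda>t. D / L * exp (L * t) - G t) has_real_derivative y) (at u) \<and> 0 \<le> y"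
        by blast
    qed
    moreover have "0 \<le> D / L * exp (L * 0)" using D \<open>L > 0\<close> by simp
    ultimately show ?thesis using G(2) by linarith
  qed
  have neg: "((\<lambda>t. - F t) has_real_derivative - f t) (at t)" for t
    by (auto intro!: derivative_eq_intros der)
  have refl: "((\<lambda>t. F (- t)) has_real_derivative - f (- t)) (at t)" for t
    using DERIV_chain2[OF der, of "\<lambda>t. - t" "-1" t UNIV] by (simp add: DERIV_minus[OF DERIV_ident])
  have refl_neg: "((\<lambda>t. - F (- t)) has_real_derivative f (- t)) (at t)" for t
    using DERIV_minus[OF refl, of t] by simp
  show ?thesis
  proof (cases "t \<ge> 0")
    case True
    then show ?thesis
      using pos[OF der, of t] pos[OF neg, of t] assms by (auto simp: abs_le_iff)
  next
    case False
    then show ?thesis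
      using pos[OF refl, of "- t"] pos[OF refl_neg, of "- t"] bound[of "- _"] assms
      by (auto simp: abs_le_iff)
  qed
qed

text \<open>Picard iteration on the whole line at once. The unknown is a bounded continuous
  \<open>w\<close> with x = x0 + exp(L|t|) w; with this weight the Picard operator contracts by
  |K|/L, so no local solutions have to be glued.\<close>

lemma bounded_lipschitz_ode_solution:
  fixes f :: "real \<Rightarrow> real \<Rightarrow> real"
  assumes cont: "\<And>x. continuous_on UNIV x \<Longrightarrow> continuous_on UNIV (\<lambda>t. f t (x t))"
    and bdd: "\<And>t x. \<bar>f t x\<bar> \<le> M"
    and lip: "\<And>t x y. \<bar>f t x - f t y\<bar> \<le> K * \<bar>x - y\<bar>"
  obtains x where "x 0 = x0" and "\<And>t. (x has_real_derivative f t (x t)) (at t)"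
proof -
  \<comment> \<open>The factor 2 makes the contraction constant at most 1/2; the summand 1 keeps
    \<open>L\<close> positive when \<open>K\<close> is 0.\<close>
  define L where "L = 2 * \<bar>K\<bar> + 1"
  have L: "L > 0" "L \<ge> 1" "\<bar>K\<bar> / L \<le> 1/2" by (auto simp: L_def field_simps)
  have M: "M \<ge> 0" using bdd[of 0 0] by linarith
  have lip: "\<bar>f t x - f t y\<bar> \<le> \<bar>K\<bar> * \<bar>x - y\<bar>" for t x y
    using lip[of t x y] by (meson abs_ge_self abs_ge_zero mult_right_mono order_trans)
  define X where "X w t = x0 + exp (L * \<bar>t\<bar>) * apply_bcontfun w t" for w t
  have contX: "continuous_on UNIV (X w)" for w
    unfolding X_def
    by (intro continuous_intros continuous_on_apply_bcontfun)
  define J where "J w = (SOME F. F 0 = 0 \<and> (\<forall>t. (F has_real_derivative f t (X w t)) (at t)))" for w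
  have J: "J w 0 = 0" "(J w has_real_derivative f t (X w t)) (at t)" for w t
  proof -
    have "\<exists>F. F 0 = 0 \<and> (\<forall>t. (F has_real_derivative f t (X w t)) (at t))"
      using continuous_antiderivative[OF cont[OF contX[of w]]]
      unfolding has_real_derivative_iff_has_vector_derivative by metis
    from someI_ex[OF this] show "J w 0 = 0" "(J w has_real_derivative f t (X w t)) (at t)"
      unfolding J_def by auto
  qed
  define T where "T w = Bcontfun (\<lambda>t. exp (- L * \<bar>t\<bar>) * J w t)" for w
  have contJ: "continuous_on UNIV (J w)" for w
    by (rule DERIV_continuous_on) (rule DERIV_subset[OF J(2)], simp)
  have "\<bar>J w t\<bar> \<le> M / L * exp (L * \<bar>t\<bar>)" for w t
  proof (rule has_real_derivative_exp_bound[OF J(2) J(1) _ L(1)])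
    show "\<bar>f t (X w t)\<bar> \<le> M * exp (L * \<bar>t\<bar>)" for t
      using bdd[of t "X w t"] M L(1) by (smt (verit) mult_le_cancel_left1 one_le_exp_iff mult_nonneg_nonneg abs_ge_zero)
  qed
  then have JM: "exp (- L * \<bar>t\<bar>) * \<bar>J w t\<bar> \<le> M / L" for w t
    by (simp add: exp_minus field_simps)
  have T: "apply_bcontfun (T w) t = exp (- L * \<bar>t\<bar>) * J w t" for w t
    unfolding T_def
  proof (subst Bcontfun_inverse)
    show "(\<lambda>t. exp (- L * \<bar>t\<bar>) * J w t) \<in> bcontfun"
      using JM by (intro bcontfun_normI[where b="M / L"] continuous_intros contJ) (auto simp: abs_mult)
  qed simp
  have "\<exists>!w. T w = w"
  proof (rule banach_fix_type[of "1/2"]; (intro allI)?)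
    show "dist (T w) (T w') \<le> (1/2) * dist w w'" for w w'
    proof (rule dist_bound)
      fix t
      have "\<bar>J w t - J w' t\<bar> \<le> (\<bar>K\<bar> * dist w w') / L * exp (L * \<bar>t\<bar>)"
      proof (rule has_real_derivative_exp_bound[OF _ _ _ L(1)])
        show "((\<lambda>t. J w t - J w' t) has_real_derivative f t (X w t) - f t (X w' t)) (at t)" for t
          by (intro derivative_intros J(2))
        show "\<bar>f t (X w t) - f t (X w' t)\<bar> \<le> \<bar>K\<bar> * dist w w' * exp (L * \<bar>t\<bar>)" for t
        proof -
          have "\<bar>X w t - X w' t\<bar> = exp (L * \<bar>t\<bar>) * dist (apply_bcontfun w t) (apply_bcontfun w' t)"
            by (simp add: X_def dist_real_def abs_mult flip: right_diff_distrib)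
          also have "\<dots> \<le> exp (L * \<bar>t\<bar>) * dist w w'"
            by (intro mult_left_mono dist_bounded) auto
          finally have "\<bar>K\<bar> * \<bar>X w t - X w' t\<bar> \<le> \<bar>K\<bar> * (exp (L * \<bar>t\<bar>) * dist w w')"
            by (intro mult_left_mono) auto
          then show ?thesis using lip[of t "X w t" "X w' t"] by (simp add: mult_ac)
        qed
      qed (simp add: J(1))
      also have "\<dots> = (\<bar>K\<bar> / L) * dist w w' * exp (L * \<bar>t\<bar>)" by simp
      also have "\<dots> \<le> 1/2 * dist w w' * exp (L * \<bar>t\<bar>)"
        using L(3) by (intro mult_right_mono) auto
      finally have "exp (- L * \<bar>t\<bar>) * \<bar>J w t - J w' t\<bar> \<le> 1/2 * dist w w'"
        by (simp add: exp_minus field_simps)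
      then show "dist (apply_bcontfun (T w) t) (apply_bcontfun (T w') t) \<le> 1/2 * dist w w'"
        by (simp add: T dist_real_def abs_mult flip: right_diff_distrib)
    qed
  qed auto
  then obtain w where w: "T w = w" by auto
  have X: "X w t = x0 + J w t" for t
    using T[of w t] by (simp add: w X_def exp_minus)
  have "X w 0 = x0" by (simp add: X J)
  moreover have "(X w has_real_derivative f t (X w t)) (at t)" for t
    using J(2)[of w t] unfolding X by (auto intro!: derivative_eq_intros)
  ultimately show ?thesis using that by blast
qed

lemma lifted_solution_exists:
  obtains x where "lifted_solution \<nu> a s x" and "x 0 = x0"
proof -
  have sin_lip: "\<bar>sin x - sin y\<bar> \<le> \<bar>x - y\<bar>" for x y :: real
    using field_differentiable_bound[of UNIV sin cos 1 y x]
    by (auto simp: DERIV_sin has_field_derivative_at_within)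
  show ?thesis
  proof (rule bounded_lipschitz_ode_solution[of "\<lambda>t x. \<nu> * sin x + a + s * sin t" "\<bar>\<nu>\<bar> + \<bar>a\<bar> + \<bar>s\<bar>" "\<bar>\<nu>\<bar>" x0])
    show "\<bar>\<nu> * sin x + a + s * sin t\<bar> \<le> \<bar>\<nu>\<bar> + \<bar>a\<bar> + \<bar>s\<bar>" for t x
    proof -
      have "\<bar>\<nu> * sin x\<bar> \<le> \<bar>\<nu>\<bar>" "\<bar>s * sin t\<bar> \<le> \<bar>s\<bar>"
        by (simp_all add: abs_mult mult_left_le)
      then show ?thesis by linarith
    qed
    show "\<bar>\<nu> * sin x + a + s * sin t - (\<nu> * sin y + a + s * sin t)\<bar> \<le> \<bar>\<nu>\<bar> * \<bar>x - y\<bar>" for t x y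
      using mult_left_mono[OF sin_lip[of x y], of "\<bar>\<nu>\<bar>"] by (simp add: abs_mult flip: right_diff_distrib)
  qed (use that in \<open>auto intro!: continuous_intros simp: lifted_solution_def\<close>)
qed

text \<open>The difference u of two solutions satisfies a linear equation u' = k u + (b - a) with
  continuous k, and \<open>exp (- K t)\<close> is its integrating factor. Comparison, uniqueness and
  continuous dependence are all read off from this one identity.\<close>

lemma lifted_solution_difference:
  assumes x: "lifted_solution \<nu> a s x" and y: "lifted_solution \<nu> b s y"
  obtains K :: "real \<Rightarrow> real" where "\<And>t. \<bar>K t\<bar> \<le> \<bar>\<nu>\<bar> * \<bar>t\<bar>"
    and "\<And>t. ((\<lambda>t. (y t - x t) * exp (- K t)) has_real_derivative (b - a) * exp (- K t)) (at t)"
proof -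
  \<comment> \<open>The quotient (sin y - sin x) / (y - x) equals
    \<open>S ((y - x) / 2) * cos ((y + x) / 2)\<close>. Filling in the value 1 at 0 keeps it
    continuous where the solutions meet.\<close>
  define S :: "real \<Rightarrow> real" where "S u = (if u = 0 then 1 else sin u / u)" for u
  have "isCont S u" for u
  proof (cases "u = 0")
    case True
    have "((\<lambda>h. (sin (0 + h) - sin 0) / h) \<longlongrightarrow> (1::real)) (at 0)"
      using DERIV_sin[of "0::real"] unfolding DERIV_def by simp
    then have "(S \<longlongrightarrow> 1) (at 0)"
      by (rule Lim_transform_eventually) (auto simp: S_def eventually_at_filter)
    then show ?thesis using True by (simp add: isCont_def S_def)
  next
    case False
    have "isCont (\<lambda>u. sin u / u) u" using False by (intro continuous_intros) auto
    moreover have "eventually (\<lambda>u. u \<noteq> 0) (nhds u)" using False by (rule t1_space_nhds)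
    ultimately show ?thesis
      by (subst isCont_cong[where g="\<lambda>u. sin u / u"]) (auto simp: S_def elim: eventually_mono)
  qed
  then have contS: "continuous_on UNIV S" by (simp add: continuous_at_imp_continuous_on)
  have absS: "\<bar>S u\<bar> \<le> 1" for u
    using abs_sin_x_le_abs_x[of u] by (auto simp: S_def)
  have dx: "(x has_real_derivative \<nu> * sin (x t) + a + s * sin t) (at t)"
    and dy: "(y has_real_derivative \<nu> * sin (y t) + b + s * sin t) (at t)" for t
    using x y by (auto simp: lifted_solution_def)
  have cont: "continuous_on UNIV x" "continuous_on UNIV y"
    by (meson DERIV_continuous_on has_field_derivative_at_within dx dy)+
  define k where "k t = \<nu> * S ((y t - x t) / 2) * cos ((y t + x t) / 2)" for t
  have k: "\<nu> * sin (y t) - \<nu> * sin (x t) = k t * (y t - x t)" for t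
    by (auto simp: k_def S_def sin_diff_sin simp flip: right_diff_distrib)
  have "\<bar>S ((y t - x t) / 2) * cos ((y t + x t) / 2)\<bar> \<le> 1" for t
    unfolding abs_mult by (rule mult_le_one) (auto intro: absS)
  then have absk: "\<bar>k t\<bar> \<le> \<bar>\<nu>\<bar>" for t
    unfolding k_def mult.assoc abs_mult[of \<nu>] by (rule mult_left_le) simp
  have "continuous_on UNIV k" unfolding k_def
    by (intro continuous_intros cont continuous_on_compose2[OF contS]) auto
  then obtain K where K: "K 0 = 0" "\<And>t. (K has_real_derivative k t) (at t)"
    using continuous_antiderivative[of k] unfolding has_real_derivative_iff_has_vector_derivative by metis
  have "\<bar>K t - K 0\<bar> \<le> \<bar>\<nu>\<bar> * \<bar>t - 0\<bar>" for t
    using field_differentiable_bound[of UNIV K k "\<bar>\<nu>\<bar>" t 0] K(2) absk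
    by (auto intro: has_field_derivative_at_within)
  then have "\<bar>K t\<bar> \<le> \<bar>\<nu>\<bar> * \<bar>t\<bar>" for t using K(1) by simp
  moreover have "((\<lambda>t. (y t - x t) * exp (- K t)) has_real_derivative (b - a) * exp (- K t)) (at t)" for t
  proof -
    have "((\<lambda>t. (y t - x t) * exp (- K t)) has_real_derivative
       ((\<nu> * sin (y t) + b + s * sin t) - (\<nu> * sin (x t) + a + s * sin t)) * exp (- K t)
       + (y t - x t) * (exp (- K t) * - k t)) (at t)"
      by (rule derivative_eq_intros dx dy K(2) refl | simp)+
    moreover have "((\<nu> * sin (y t) + b + s * sin t) - (\<nu> * sin (x t) + a + s * sin t)) * exp (- K t)
       + (y t - x t) * (exp (- K t) * - k t) = (b - a) * exp (- K t)"
      using arg_cong[OF k[of t], of "\<lambda>z. z * exp (- K t)"] by (simp add: algebra_simps)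
    ultimately show ?thesis by simp
  qed
  ultimately show ?thesis using that by blast
qed

lemma lifted_solution_mono:
  assumes x: "lifted_solution \<nu> a s x" and y: "lifted_solution \<nu> b s y"
    and "a \<le> b" "x 0 \<le> y 0" "t \<ge> 0"
  shows "x t \<le> y t"
proof -
  obtain K where K: "\<And>t. ((\<lambda>t. (y t - x t) * exp (- K t)) has_real_derivative (b - a) * exp (- K t)) (at t)"
    using lifted_solution_difference[OF x y] by metis
  have "(y 0 - x 0) * exp (- K 0) \<le> (y t - x t) * exp (- K t)"
  proof (rule DERIV_nonneg_imp_nondecreasing[OF \<open>t \<ge> 0\<close>])
    show "\<exists>d. ((\<lambda>t. (y t - x t) * exp (- K t)) has_real_derivative d) (at u) \<and> 0 \<le> d" for u
      using K[of u] \<open>a \<le> b\<close> by (intro exI[of _ "(b - a) * exp (- K u)"]) simp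
  qed
  moreover have "0 \<le> (y 0 - x 0) * exp (- K 0)" using assms by simp
  ultimately have "0 \<le> (y t - x t) * exp (- K t)" by linarith
  then show ?thesis by (simp add: zero_le_mult_iff)
qed

lemma lifted_solution_strict_mono:
  assumes x: "lifted_solution \<nu> a s x" and y: "lifted_solution \<nu> b s y"
    and "a < b" "x 0 \<le> y 0" "t > 0"
  shows "x t < y t"
proof -
  obtain K where K: "\<And>t. ((\<lambda>t. (y t - x t) * exp (- K t)) has_real_derivative (b - a) * exp (- K t)) (at t)"
    using lifted_solution_difference[OF x y] by metis
  have "(y 0 - x 0) * exp (- K 0) < (y t - x t) * exp (- K t)"
  proof (rule DERIV_pos_imp_increasing[OF \<open>t > 0\<close>])
    show "\<exists>d. ((\<lambda>t. (y t - x t) * exp (- K t)) has_real_derivative d) (at u) \<and> 0 < d" for u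
      using K[of u] \<open>a < b\<close> by (intro exI[of _ "(b - a) * exp (- K u)"]) simp
  qed
  moreover have "0 \<le> (y 0 - x 0) * exp (- K 0)" using assms by simp
  ultimately have "0 < (y t - x t) * exp (- K t)" by linarith
  then show ?thesis by (simp add: zero_less_mult_iff)
qed

lemma lifted_solution_unique:
  assumes x: "lifted_solution \<nu> a s x" and y: "lifted_solution \<nu> a s y" and "x 0 = y 0"
  shows "x = y"
proof
  fix t
  obtain K where K: "\<And>t. ((\<lambda>t. (y t - x t) * exp (- K t)) has_real_derivative (a - a) * exp (- K t)) (at t)"
    using lifted_solution_difference[OF x y] by metis
  have "(y t - x t) * exp (- K t) = (y 0 - x 0) * exp (- K 0)"
    using K by (intro DERIV_isconst_all) auto
  then show "x t = y t" using \<open>x 0 = y 0\<close> by simp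
qed

text \<open>The integrating factor costs exp(|nu| t) twice, once in bounding the source term and
  once in being undone; hence the 2 in the exponent.\<close>

lemma lifted_solution_dependence:
  assumes x: "lifted_solution \<nu> a s x" and y: "lifted_solution \<nu> b s y" and "t \<ge> 0"
  shows "\<bar>y t - x t\<bar> \<le> exp (2 * \<bar>\<nu>\<bar> * t) * (\<bar>y 0 - x 0\<bar> + \<bar>b - a\<bar> * t)"
proof -
  obtain K where K: "\<And>t. \<bar>K t\<bar> \<le> \<bar>\<nu>\<bar> * \<bar>t\<bar>"
    "\<And>t. ((\<lambda>t. (y t - x t) * exp (- K t)) has_real_derivative (b - a) * exp (- K t)) (at t)"
    using lifted_solution_difference[OF x y] by metis
  let ?u = "\<lambda>t. (y t - x t) * exp (- K t)"
  have "norm (?u t - ?u 0) \<le> (\<bar>b - a\<bar> * exp (\<bar>\<nu>\<bar> * t)) * norm (t - 0)"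
  proof (rule field_differentiable_bound[of "{0..t}"])
    fix z assume z: "z \<in> {0..t}"
    show "(?u has_real_derivative (b - a) * exp (- K z)) (at z within {0..t})"
      using K(2) by (rule has_field_derivative_at_within)
    have "\<bar>\<nu>\<bar> * \<bar>z\<bar> \<le> \<bar>\<nu>\<bar> * t" using z by (intro mult_left_mono) auto
    then have "- K z \<le> \<bar>\<nu>\<bar> * t" using K(1)[of z] by linarith
    then show "norm ((b - a) * exp (- K z)) \<le> \<bar>b - a\<bar> * exp (\<bar>\<nu>\<bar> * t)"
      by (simp add: abs_mult mult_left_mono)
  qed (use \<open>t \<ge> 0\<close> in auto)
  moreover have "K 0 = 0" using K(1)[of 0] by simp
  ultimately have "\<bar>?u t - (y 0 - x 0)\<bar> \<le> exp (\<bar>\<nu>\<bar> * t) * (\<bar>b - a\<bar> * t)"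
    using \<open>t \<ge> 0\<close> by (simp add: mult_ac)
  moreover have "\<bar>y 0 - x 0\<bar> \<le> exp (\<bar>\<nu>\<bar> * t) * \<bar>y 0 - x 0\<bar>"
    using \<open>t \<ge> 0\<close> by (simp add: mult_le_cancel_right1)
  ultimately have u: "\<bar>?u t\<bar> \<le> exp (\<bar>\<nu>\<bar> * t) * (\<bar>y 0 - x 0\<bar> + \<bar>b - a\<bar> * t)"
    unfolding distrib_left by linarith
  have "\<bar>y t - x t\<bar> = \<bar>?u t\<bar> * exp (K t)" by (simp add: abs_mult exp_minus)
  also have "\<dots> \<le> (exp (\<bar>\<nu>\<bar> * t) * (\<bar>y 0 - x 0\<bar> + \<bar>b - a\<bar> * t)) * exp (\<bar>\<nu>\<bar> * t)"
    using K(1)[of t] \<open>t \<ge> 0\<close> by (intro mult_mono u) (auto simp: abs_le_iff)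
  also have "\<dots> = exp (2 * \<bar>\<nu>\<bar> * t) * (\<bar>y 0 - x 0\<bar> + \<bar>b - a\<bar> * t)"
    by (simp add: mult_ac flip: exp_add)
  finally show ?thesis .
qed

lemma lifted_solution_shift_time:
  "lifted_solution \<nu> a s x \<Longrightarrow> lifted_solution \<nu> a s (\<lambda>t. x (t + 2 * pi))"
  using DERIV_shift unfolding lifted_solution_def by (metis sin_periodic)

lemma lifted_solution_shift_space:
  "lifted_solution \<nu> a s x \<Longrightarrow> lifted_solution \<nu> a s (\<lambda>t. x t + 2 * pi * real_of_int k)"
  unfolding lifted_solution_def
  by (auto intro!: derivative_eq_intros simp: sin_add cos_int_2pin sin_int_2pin)

text \<open>The shift by half a period changes the sign of sin t, and the reflection of x changes it
  back: \<open>s\<close> stays and only \<open>a\<close> changes sign.\<close>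

lemma lifted_solution_reflect:
  assumes "lifted_solution \<nu> a s x"
  shows "lifted_solution \<nu> (- a) s (\<lambda>t. - x (t + pi))"
  unfolding lifted_solution_def
proof
  fix t
  have "((\<lambda>t. x (t + pi)) has_real_derivative \<nu> * sin (x (t + pi)) + a + s * sin (t + pi)) (at t)"
    using assms unfolding lifted_solution_def DERIV_shift by (metis DERIV_shift)
  then show "((\<lambda>t. - x (t + pi)) has_real_derivative \<nu> * sin (- x (t + pi)) + - a + s * sin t) (at t)"
    by (auto intro!: derivative_eq_intros)
qed

section \<open>The flow and the period map on the line\<close>

definition flow :: "real \<Rightarrow> real \<Rightarrow> real \<Rightarrow> real \<Rightarrow> real \<Rightarrow> real" where
  "flow \<nu> a s x0 = (SOME x. lifted_solution \<nu> a s x \<and> x 0 = x0)"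

lemma flow_solution: "lifted_solution \<nu> a s (flow \<nu> a s x0)"
  and flow_0 [simp]: "flow \<nu> a s x0 0 = x0"
proof -
  have "\<exists>x. lifted_solution \<nu> a s x \<and> x 0 = x0" using lifted_solution_exists by metis
  from someI_ex[OF this] show "lifted_solution \<nu> a s (flow \<nu> a s x0)" "flow \<nu> a s x0 0 = x0"
    by (auto simp: flow_def)
qed

lemma flow_eq: "lifted_solution \<nu> a s x \<Longrightarrow> flow \<nu> a s (x 0) = x"
  by (rule lifted_solution_unique[OF flow_solution]) auto

definition period_map :: "real \<Rightarrow> real \<Rightarrow> real \<Rightarrow> real \<Rightarrow> real" where
  "period_map \<nu> a s x0 = flow \<nu> a s x0 (2 * pi)"

lemma lifted_solution_period_map:
  "lifted_solution \<nu> a s x \<Longrightarrow> x (t + 2 * pi) = flow \<nu> a s (period_map \<nu> a s (x 0)) t"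
  using flow_eq[OF lifted_solution_shift_time, of \<nu> a s x] flow_eq[of \<nu> a s x]
  unfolding period_map_def by (metis add_0)

lemma lifted_solution_iterate:
  assumes "lifted_solution \<nu> a s x"
  shows "x (2 * pi * real n) = (period_map \<nu> a s ^^ n) (x 0)"
  using assms
proof (induction n arbitrary: x)
  case (Suc n)
  have "x (2 * pi * real (Suc n)) = x (2 * pi * real n + 2 * pi)" by (simp add: algebra_simps)
  also have "\<dots> = (period_map \<nu> a s ^^ n) (x (0 + 2 * pi))"
    using Suc.IH[OF lifted_solution_shift_time[OF Suc.prems]] by simp
  also have "x (0 + 2 * pi) = period_map \<nu> a s (x 0)"
    using lifted_solution_period_map[OF Suc.prems, of 0] by simp
  finally show ?case by (simp only: funpow_Suc_right o_apply)
qed simp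

lemma flow_add: "flow \<nu> a s (x0 + 2 * pi * real_of_int k) t = flow \<nu> a s x0 t + 2 * pi * real_of_int k"
  using flow_eq[OF lifted_solution_shift_space[OF flow_solution], of \<nu> a s x0 k] by (auto dest: fun_cong)

lemma period_map_mono: "a \<le> b \<Longrightarrow> x \<le> y \<Longrightarrow> period_map \<nu> a s x \<le> period_map \<nu> b s y"
  unfolding period_map_def by (rule lifted_solution_mono[OF flow_solution flow_solution]) auto

lemma period_map_strict_mono: "a < b \<Longrightarrow> period_map \<nu> a s x < period_map \<nu> b s x"
  unfolding period_map_def by (rule lifted_solution_strict_mono[OF flow_solution flow_solution]) auto

lemma continuous_period_map: "continuous_on UNIV (period_map \<nu> a s)"
  and continuous_period_map_param: "continuous_on UNIV (\<lambda>a. period_map \<nu> a s x)"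
proof -
  let ?L = "exp (2 * \<bar>\<nu>\<bar> * (2 * pi))"
  have "(?L * 2 * pi)-lipschitz_on UNIV (\<lambda>a. period_map \<nu> a s x)"
    using lifted_solution_dependence[OF flow_solution flow_solution, of "2 * pi" \<nu> _ s x _ x]
    by (intro lipschitz_onI) (auto simp: period_map_def dist_real_def mult_ac)
  then show "continuous_on UNIV (\<lambda>a. period_map \<nu> a s x)" by (rule lipschitz_on_continuous_on)
  have "?L-lipschitz_on UNIV (period_map \<nu> a s)"
    using lifted_solution_dependence[OF flow_solution flow_solution, of "2 * pi" \<nu> a s _ a]
    by (intro lipschitz_onI) (auto simp: period_map_def dist_real_def)
  then show "continuous_on UNIV (period_map \<nu> a s)" by (rule lipschitz_on_continuous_on)
qed

section \<open>The linear system\<close>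

definition linear_solution ::
    "real \<Rightarrow> real \<Rightarrow> real \<Rightarrow> (real \<Rightarrow> complex) \<Rightarrow> (real \<Rightarrow> complex) \<Rightarrow> bool" where
  "linear_solution \<nu> a s v w \<longleftrightarrow>
     (\<forall>t. (v has_vector_derivative - (of_real \<nu> / 2) * w t) (at t) \<and>
          (w has_vector_derivative
             - (of_real \<nu> / 2) * v t + \<i> * of_real (a + s * sin t) * w t) (at t))"

lemma linear_solutionD:
  assumes "linear_solution \<nu> a s v w"
  shows "(v has_vector_derivative - (of_real \<nu> / 2) * w t) (at t within A)"
    and "(w has_vector_derivative
             - (of_real \<nu> / 2) * v t + \<i> * of_real (a + s * sin t) * w t) (at t within A)"
  using assms unfolding linear_solution_def by (auto intro: has_vector_derivative_at_within)

lemma linear_solution_continuous: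
  assumes "linear_solution \<nu> a s v w"
  shows "continuous_on A v" "continuous_on A w"
  by (rule continuous_on_vector_derivative linear_solutionD[OF assms])+

lemma linear_solution_combine:
  assumes "linear_solution \<nu> a s v w" "linear_solution \<nu> a s v' w'"
  shows "linear_solution \<nu> a s (\<lambda>t. c * v t + d * v' t) (\<lambda>t. c * w t + d * w' t)"
  unfolding linear_solution_def
  by (auto intro!: derivative_eq_intros linear_solutionD[OF assms(1)] linear_solutionD[OF assms(2)]
      simp: algebra_simps)

text \<open>The coefficient matrix is skew for the indefinite form |w|^2 - |v|^2, so the linear flow
  lies in U(1,1). This is why the quotients w / v move by Moebius transformations that preserve the
  disc.\<close>

lemma linear_solution_hermitian:
  assumes v: "linear_solution \<nu> a s v w" and v': "linear_solution \<nu> a s v' w'"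
  shows "cnj (w t) * w' t - cnj (v t) * v' t = cnj (w 0) * w' 0 - cnj (v 0) * v' 0"
proof -
  let ?H = "\<lambda>t. cnj (w t) * w' t - cnj (v t) * v' t"
  have "(?H has_vector_derivative 0) (at t within UNIV)" for t
    by (rule derivative_eq_intros linear_solutionD[OF v] linear_solutionD[OF v'] refl)+
       (simp add: algebra_simps)
  then obtain c where "\<And>t. t \<in> UNIV \<Longrightarrow> ?H t = c"
    using has_vector_derivative_zero_constant[of UNIV ?H] by (metis convex_UNIV)
  then show ?thesis by simp
qed

lemma linear_solution_norm:
  assumes "linear_solution \<nu> a s v w"
  shows "(norm (w t))\<^sup>2 - (norm (v t))\<^sup>2 = (norm (w 0))\<^sup>2 - (norm (v 0))\<^sup>2"
proof -
  have "complex_of_real ((norm (w t))\<^sup>2 - (norm (v t))\<^sup>2) = of_real ((norm (w 0))\<^sup>2 - (norm (v 0))\<^sup>2)"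
    using linear_solution_hermitian[OF assms assms, of t]
    by (simp add: mult.commute[of "cnj _"] flip: complex_norm_square)
  then show ?thesis by (simp only: of_real_eq_iff)
qed

text \<open>Liouville's formula: the trace of the system is i (a + s sin t), with antiderivative i
  (a t - s (cos t - 1)).\<close>

lemma linear_solution_wronskian:
  assumes v: "linear_solution \<nu> a s v w" and v': "linear_solution \<nu> a s v' w'"
  shows "v t * w' t - w t * v' t = (v 0 * w' 0 - w 0 * v' 0) * cis (a * t - s * (cos t - 1))"
proof -
  let ?W = "\<lambda>t. (v t * w' t - w t * v' t) * cis (- (a * t - s * (cos t - 1)))"
  have cis: "((\<lambda>t. cis (- (a * t - s * (cos t - 1)))) has_vector_derivative
      of_real (- (a + s * sin t)) * (\<i> * cis (- (a * t - s * (cos t - 1))))) (at t)" for t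
    unfolding has_vector_derivative_def
    by (rule derivative_eq_intros refl)+ (simp add: fun_eq_iff scaleR_conv_of_real algebra_simps)
  have "(?W has_vector_derivative 0) (at t within UNIV)" for t
    by (rule derivative_eq_intros linear_solutionD[OF v] linear_solutionD[OF v'] cis refl)+
       (simp add: algebra_simps)
  then obtain c where c: "\<And>t. t \<in> UNIV \<Longrightarrow> ?W t = c"
    using has_vector_derivative_zero_constant[of UNIV ?W] by (metis convex_UNIV)
  have "?W t = ?W 0" using c by (metis UNIV_I)
  then have "v t * w' t - w t * v' t
      = (v 0 * w' 0 - w 0 * v' 0) / cis (- (a * t - s * (cos t - 1)))"
    by (simp add: field_simps)
  then show ?thesis by (simp only: divide_inverse cis_inverse minus_minus)
qed

lemma linear_solution_wronskian_nonzero: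
  assumes "linear_solution \<nu> a s v w" and "linear_solution \<nu> a s v' w'"
    and "v 0 * w' 0 \<noteq> w 0 * v' 0"
  shows "v t * w' t \<noteq> w t * v' t"
  using linear_solution_wronskian[OF assms(1,2), of t] assms(3) by auto

text \<open>With w = cis(x) v the first equation reads v'/v = -(nu/2) cis(x), which is solved by the
  exponential of an antiderivative. Solutions of the linear system are thereby obtained from the
  scalar equation.\<close>

lemma linear_solution_of_lifted_solution:
  assumes x: "lifted_solution \<nu> a s x"
  obtains G where "G 0 = 0" "\<And>t. (G has_vector_derivative cis (x t)) (at t)"
    "linear_solution \<nu> a s (\<lambda>t. exp (- (of_real \<nu> / 2) * G t))
       (\<lambda>t. cis (x t) * exp (- (of_real \<nu> / 2) * G t))"
proof -
  have dx: "(x has_real_derivative \<nu> * sin (x t) + a + s * sin t) (at t)" for t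
    using x by (auto simp: lifted_solution_def)
  have "continuous_on UNIV x"
    by (meson DERIV_continuous_on has_field_derivative_at_within dx)
  then obtain G where G: "G 0 = 0" "\<And>t. (G has_vector_derivative cis (x t)) (at t)"
    using continuous_antiderivative[of "\<lambda>t. cis (x t)"] by (auto intro: continuous_intros)
  let ?v = "\<lambda>t. exp (- (of_real \<nu> / 2) * G t)"
  have dv: "(?v has_vector_derivative - (of_real \<nu> / 2) * (cis (x t) * ?v t)) (at t)" for t
  proof -
    have "(?v has_vector_derivative (- (of_real \<nu> / 2) * cis (x t)) * exp (- (of_real \<nu> / 2) * G t)) (at t)"
      using field_vector_diff_chain_at[OF has_vector_derivative_mult_right[OF G(2)[of t]] DERIV_exp,
          of "- (of_real \<nu> / 2)"] by (simp add: o_def)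
    then show ?thesis by (simp add: mult_ac)
  qed
  have dcis: "((\<lambda>t. cis (x t)) has_vector_derivative
      of_real (\<nu> * sin (x t) + a + s * sin t) * (\<i> * cis (x t))) (at t)" for t
    using has_derivative_cis[OF dx[of t, unfolded has_field_derivative_def]]
    by (simp add: has_vector_derivative_def scaleR_conv_of_real mult_ac)
  have "linear_solution \<nu> a s ?v (\<lambda>t. cis (x t) * ?v t)"
    unfolding linear_solution_def
  proof (intro allI conjI)
    fix t
    show "(?v has_vector_derivative - (of_real \<nu> / 2) * (cis (x t) * ?v t)) (at t)" by (rule dv)
    have sin: "2 * \<i> * of_real (sin (x t)) * cis (x t) = (cis (x t))\<^sup>2 - 1"
      by (simp add: complex_eq_iff power2_eq_square algebra_simps)
    have "((\<lambda>t. cis (x t) * ?v t) has_vector_derivative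
      cis (x t) * (- (of_real \<nu> / 2) * (cis (x t) * ?v t)) +
      of_real (\<nu> * sin (x t) + a + s * sin t) * (\<i> * cis (x t)) * ?v t) (at t)"
      by (rule has_vector_derivative_mult dcis dv)+
    moreover have "cis (x t) * (- (of_real \<nu> / 2) * (cis (x t) * ?v t)) +
        of_real (\<nu> * sin (x t) + a + s * sin t) * (\<i> * cis (x t)) * ?v t =
      (of_real \<nu> / 2) * (2 * \<i> * of_real (sin (x t)) * cis (x t) - (cis (x t))\<^sup>2) * ?v t
        + \<i> * of_real (a + s * sin t) * (cis (x t) * ?v t)"
      by (simp add: field_simps power2_eq_square)
    ultimately show "((\<lambda>t. cis (x t) * ?v t) has_vector_derivative
       - (of_real \<nu> / 2) * ?v t + \<i> * of_real (a + s * sin t) * (cis (x t) * ?v t)) (at t)"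
      unfolding sin by simp
  qed
  then show ?thesis using that G by blast
qed

text \<open>The scalar solutions starting at 0 and at pi have the initial vectors (1, 1) and (1,
  -1); half their sum and half their difference give the standard basis.\<close>

lemma linear_solution_basis:
  obtains v w v' w' where "linear_solution \<nu> a s v w" "v 0 = 1" "w 0 = 0"
    "linear_solution \<nu> a s v' w'" "v' 0 = 0" "w' 0 = 1"
proof -
  obtain p q where p: "linear_solution \<nu> a s p q" "p 0 = 1" "q 0 = 1"
    using linear_solution_of_lifted_solution[OF flow_solution[of \<nu> a s 0]] by (metis
      (no_types, lifting) flow_0 cis_zero exp_zero mult_zero_right mult_1)
  obtain p' q' where p': "linear_solution \<nu> a s p' q'" "p' 0 = 1" "q' 0 = -1"
    using linear_solution_of_lifted_solution[OF flow_solution[of \<nu> a s pi]] by (metis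
      (no_types, lifting) flow_0 cis_pi exp_zero mult_zero_right mult_1_right)
  show ?thesis
    by (rule that[OF linear_solution_combine[OF p(1) p'(1), of "1/2" "1/2"] _ _
          linear_solution_combine[OF p(1) p'(1), of "1/2" "- 1/2"]])
       (simp_all add: p p')
qed

section \<open>Rotation number and tongues\<close>

lemma rotation_tendsto:
  assumes x: "lifted_solution \<nu> a s x"
    and B: "\<And>n. \<bar>(period_map \<nu> a s ^^ n) (x 0) - x 0 - 2 * pi * \<rho> * real n\<bar> \<le> B"
  shows "(\<lambda>n. (x (2 * pi * real n) - x 0) / (2 * pi * real n)) \<longlonglongrightarrow> \<rho>"
proof -
  have "(\<lambda>n. (x (2 * pi * real n) - x 0) / (2 * pi * real n) - \<rho>) \<longlonglongrightarrow> 0"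
  proof (rule Lim_null_comparison)
    show "\<forall>\<^sub>F n in sequentially. norm ((x (2 * pi * real n) - x 0) / (2 * pi * real n) - \<rho>)
        \<le> B / (2 * pi) / real n"
      using eventually_gt_at_top[of "0::nat"]
    proof eventually_elim
      case (elim n)
      have "(x (2 * pi * real n) - x 0) / (2 * pi * real n) - \<rho>
          = ((period_map \<nu> a s ^^ n) (x 0) - x 0 - 2 * pi * \<rho> * real n) / (2 * pi * real n)"
        using elim unfolding lifted_solution_iterate[OF x] by (simp add: field_simps)
      then show ?case using B[of n] elim by (simp add: divide_right_mono)
    qed
    show "(\<lambda>n. B / (2 * pi) / real n) \<longlonglongrightarrow> 0"
      by (rule lim_const_over_n)
  qed
  then show ?thesis by (rule LIM_zero_cancel)
qed

lemma rotation_number_unique: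
  assumes "\<And>x. lifted_solution \<nu> a s x \<Longrightarrow>
     (\<lambda>n. (x (2 * pi * real n) - x 0) / (2 * pi * real n)) \<longlonglongrightarrow> \<rho>"
  shows "rotation_number \<nu> a s = \<rho>"
  unfolding rotation_number_def
  using assms flow_solution LIMSEQ_unique by (intro the_equality) blast+

text \<open>Every orbit is trapped between two neighbouring translates of the orbit of
  \<open>y\<close>, so its deviation from uniform motion never exceeds 2 pi.\<close>

lemma rotation_number_fixed_point:
  assumes fixed: "period_map \<nu> a s y = y + 2 * pi * real_of_int k" and x: "lifted_solution \<nu> a s x"
  shows "(\<lambda>n. (x (2 * pi * real n) - x 0) / (2 * pi * real n)) \<longlonglongrightarrow> real_of_int k"
proof (rule rotation_tendsto[OF x, of _ "2 * pi"])
  fix n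
  have shift: "period_map \<nu> a s (z + 2 * pi * real_of_int j) = period_map \<nu> a s z + 2 * pi * real_of_int j" for z j
    by (simp add: period_map_def flow_add)
  have orbit: "(period_map \<nu> a s ^^ n) (y + 2 * pi * real_of_int j)
      = y + 2 * pi * real_of_int j + 2 * pi * real_of_int k * real n" for j
  proof (induction n)
    case (Suc n)
    have "y + 2 * pi * real_of_int j + 2 * pi * real_of_int k * real n
        = y + 2 * pi * real_of_int (j + k * int n)" by (simp add: algebra_simps)
    then show ?case using Suc shift[of y "j + k * int n"] by (simp add: fixed algebra_simps)
  qed simp
  obtain j where "(x 0 - y) - 2 * pi * real_of_int j \<in> {0..0 + 2 * pi}" by (rule reduce_mod_2pi)
  then have j: "y + 2 * pi * real_of_int j \<le> x 0" "x 0 \<le> y + 2 * pi * real_of_int (j + 1)"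
    by (simp_all add: algebra_simps)
  have "mono (period_map \<nu> a s ^^ n)"
    by (rule mono_pow) (auto intro: monoI period_map_mono)
  from monoD[OF this j(1)] monoD[OF this j(2)]
  show "\<bar>(period_map \<nu> a s ^^ n) (x 0) - x 0 - 2 * pi * real_of_int k * real n\<bar> \<le> 2 * pi"
    using j unfolding orbit by (simp add: algebra_simps)
qed

text \<open>A \<open>2\<pi>\<close>-periodic orbit, inside the unit disc, of the Riccati equation that \<open>cis (x t)\<close>
  satisfies for every solution \<open>x\<close>.\<close>

definition disc_orbit :: "real \<Rightarrow> real \<Rightarrow> real \<Rightarrow> (real \<Rightarrow> complex) \<Rightarrow> bool" where
  "disc_orbit \<nu> a s \<Phi> \<longleftrightarrow> \<Phi> (2 * pi) = \<Phi> 0 \<and>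
     (\<forall>t. norm (\<Phi> t) < 1 \<and>
        (\<Phi> has_vector_derivative
           of_real (\<nu> / 2) * ((\<Phi> t)\<^sup>2 - 1) + \<i> * of_real (a + s * sin t) * \<Phi> t) (at t))"

section \<open>Fixed points in the closed disc and the Moebius angle\<close>

lemma cis_eq_cisD:
  assumes "cis x = cis y"
  obtains k :: int where "x = y + 2 * pi * real_of_int k"
  using assms sin_cos_eq_iff[of x y] by (auto simp: complex_eq_iff)

lemma fixed_point_or_disc_orbit:
  obtains (fixed) x k where "period_map \<nu> a s x = x + 2 * pi * real_of_int k"
  | (disc) \<Phi> where "disc_orbit \<nu> a s \<Phi>"
proof -
  obtain v w v' w' where basis: "linear_solution \<nu> a s v w" "v 0 = 1" "w 0 = 0"
    "linear_solution \<nu> a s v' w'" "v' 0 = 0" "w' 0 = 1"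
    by (rule linear_solution_basis)
  define V where "V p t = v t + p * v' t" for p t
  define W where "W p t = w t + p * w' t" for p t
  have lin: "linear_solution \<nu> a s (V p) (W p)" and init: "V p 0 = 1" "W p 0 = p" for p
    using linear_solution_combine[OF basis(1,4), of 1 p] basis
    by (simp_all add: V_def[abs_def] W_def[abs_def])
  have norms: "(norm (W p t))\<^sup>2 - (norm (V p t))\<^sup>2 = (norm p)\<^sup>2 - 1" for p t
    using linear_solution_norm[OF lin, of p t] by (simp add: init)
  \<comment> \<open>If \<open>V p t\<close> vanished, the conserved form would force
    \<open>W p t\<close> to vanish as well, contradicting the independence of the basis. So the
    quotient is defined on the whole closed disc.\<close>
  have nz: "V p t \<noteq> 0" if "norm p \<le> 1" for p t
  proof
    assume 0: "V p t = 0"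
    have "(norm p)\<^sup>2 \<le> 1" using that by (simp add: power_le_one)
    then have "(norm (W p t))\<^sup>2 \<le> 0" using norms[of p t] 0 by simp
    then have "W p t = 0" by simp
    then have "v t * w' t = w t * v' t"
      using 0 unfolding V_def W_def by (metis add_eq_0_iff2 minus_mult_left mult.assoc mult.commute)
    then show False
      using linear_solution_wronskian_nonzero[OF basis(1,4), of t] basis by simp
  qed
  have ratio_le: "norm (W p t / V p t) \<le> 1" if "norm p \<le> 1" for p t
  proof -
    have "(norm p)\<^sup>2 \<le> 1" using that by (simp add: power_le_one)
    then have "(norm (W p t))\<^sup>2 \<le> (norm (V p t))\<^sup>2" using norms[of p t] by linarith
    then have "norm (W p t) \<le> norm (V p t)" by (rule power2_le_imp_le) simp
    then show ?thesis using nz[OF that] by (simp add: norm_divide)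
  qed
  define f where "f p = W p (2 * pi) / V p (2 * pi)" for p
  have "continuous_on (cball 0 1) f"
    unfolding f_def using nz by (intro continuous_intros) (auto simp: V_def W_def intro!: continuous_intros)
  moreover have "f \<in> cball 0 1 \<rightarrow> cball 0 1"
    using ratio_le by (auto simp: f_def)
  ultimately obtain p where p: "norm p \<le> 1" "f p = p"
    using brouwer_ball[of 1 0 f] by auto
  show thesis
  proof (cases "norm p = 1")
    case True
    define \<theta> where "\<theta> = Arg p"
    have \<theta>: "p = cis \<theta>" using rcis_cmod_Arg[of p] True by (simp add: rcis_def \<theta>_def)
    let ?x = "flow \<nu> a s \<theta>"
    obtain G where "linear_solution \<nu> a s (\<lambda>t. exp (- (of_real \<nu> / 2) * G t))
       (\<lambda>t. cis (?x t) * exp (- (of_real \<nu> / 2) * G t))"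
      by (rule linear_solution_of_lifted_solution[OF flow_solution[of \<nu> a s \<theta>]])
    moreover define z where "z t = exp (- (of_real \<nu> / 2) * G t)" for t
    ultimately have z: "linear_solution \<nu> a s z (\<lambda>t. cis (?x t) * z t)" "\<And>t. z t \<noteq> 0"
      by (simp_all add: z_def[abs_def])
    \<comment> \<open>The two linear solutions start from proportional vectors, so their Wronskian
      is 0 throughout and their quotients agree at time 2 pi.\<close>
    have "V p (2 * pi) * (cis (?x (2 * pi)) * z (2 * pi)) = W p (2 * pi) * z (2 * pi)"
      using linear_solution_wronskian[OF lin z(1), of p "2 * pi"] by (simp add: init \<theta>)
    then have "cis (?x (2 * pi)) = f p"
      using z(2) nz[OF p(1)] by (simp add: f_def field_simps)
    then have "cis (period_map \<nu> a s \<theta>) = cis \<theta>"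
      using p(2) \<theta> by (simp add: period_map_def)
    then show ?thesis using fixed by (metis cis_eq_cisD)
  next
    case False
    then have "(norm p)\<^sup>2 < 1" using p(1) by (simp add: power_less_one_iff)
    then have "(norm (W p t))\<^sup>2 < (norm (V p t))\<^sup>2" for t
      using norms[of p t] by linarith
    then have lt: "norm (W p t) < norm (V p t)" for t
      by (rule power2_less_imp_less) simp
    define \<Phi> where "\<Phi> t = W p t / V p t" for t
    have "disc_orbit \<nu> a s \<Phi>"
      unfolding disc_orbit_def
    proof (intro allI conjI)
      show "\<Phi> (2 * pi) = \<Phi> 0" using p(2) by (simp add: \<Phi>_def f_def init)
      fix t
      show "norm (\<Phi> t) < 1" using lt nz[OF p(1)] by (simp add: \<Phi>_def norm_divide)
      let ?W' = "- (of_real \<nu> / 2) * V p t + \<i> * of_real (a + s * sin t) * W p t"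
      have "((\<lambda>t. inverse (V p t)) has_vector_derivative
          - (of_real \<nu> / 2) * W p t * (- (inverse (V p t) ^ Suc (Suc 0)))) (at t)"
        using field_vector_diff_chain_at[OF linear_solutionD(1)[OF lin[of p], of t UNIV] DERIV_inverse[OF nz[OF p(1), of t]]]
        unfolding o_def .
      from has_vector_derivative_mult[OF linear_solutionD(2)[OF lin, of p t UNIV] this]
      have "(\<Phi> has_vector_derivative W p t * (- (of_real \<nu> / 2) * W p t * (- (inverse (V p t) ^ Suc (Suc 0))))
          + ?W' * inverse (V p t)) (at t)"
        unfolding \<Phi>_def divide_inverse .
      moreover have "w0 * (- n * w0 * (- (u ^ Suc (Suc 0)))) + (- n * v0 + c * w0) * u =
          n * ((w0 * u)\<^sup>2 - v0 * u) + c * (w0 * u)" for w0 n u v0 c :: complex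
        by (simp add: algebra_simps power2_eq_square)
      ultimately have "(\<Phi> has_vector_derivative of_real \<nu> / 2 * ((W p t * inverse (V p t))\<^sup>2 - V p t * inverse (V p t))
          + \<i> * of_real (a + s * sin t) * (W p t * inverse (V p t))) (at t)" by (simp only:)
      moreover have "V p t * inverse (V p t) = 1" using nz[OF p(1), of t] by simp
      moreover have "of_real \<nu> / 2 = complex_of_real (\<nu> / 2)" by simp
      ultimately show "(\<Phi> has_vector_derivative
          of_real (\<nu> / 2) * ((\<Phi> t)\<^sup>2 - 1) + \<i> * of_real (a + s * sin t) * \<Phi> t) (at t)"
        by (simp only: \<Phi>_def divide_inverse)
    qed
    then show ?thesis by (rule disc)
  qed
qed

text \<open>The left-out middle term is the Poisson kernel (1 - |q|^2) / |1 - q|^2, and |1 - q| is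
  at most 2. In the derivative of the angle it measures how a change of the parameter speeds up the
  rotation.\<close>

lemma Re_cayley_lower_bound:
  assumes "norm q < 1"
  shows "(1 - (norm q)\<^sup>2) / 4 \<le> Re ((1 + q) / (1 - q))"
proof -
  have "1 - q \<noteq> 0" using assms by auto
  have "norm (1 - q) \<le> 2" using norm_triangle_ineq4[of 1 q] assms by simp
  then have le: "(norm (1 - q))\<^sup>2 \<le> 4" using power_mono[of "norm (1 - q)" 2 2] by simp
  have "Re ((1 + q) / (1 - q)) = (1 - (norm q)\<^sup>2) / (norm (1 - q))\<^sup>2"
    unfolding Re_divide cmod_power2
    by (rule arg_cong2[where f = "(/)"]) (simp_all add: power2_eq_square algebra_simps)
  moreover have "(1 - (norm q)\<^sup>2) / 4 \<le> (1 - (norm q)\<^sup>2) / (norm (1 - q))\<^sup>2"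
    using assms le \<open>1 - q \<noteq> 0\<close> by (intro divide_left_mono) (auto simp: power_le_one)
  ultimately show ?thesis by simp
qed

text \<open>The angle of \<open>cis (y t)\<close>, seen from the interior point \<open>\<Phi> t\<close> of the disc: the Moebius
  transformation moving \<open>\<Phi> t\<close> to \<open>0\<close> turns the equation with parameter \<open>a\<close> into a rotation.\<close>

lemma disc_orbit_angle:
  assumes \<Phi>: "disc_orbit \<nu> a s \<Phi>" and y: "lifted_solution \<nu> b s y"
  shows "((\<lambda>t. y t + 2 * Im (Ln (1 - \<Phi> t * cis (- y t)))) has_real_derivative
     a + s * sin t + \<nu> * Im (\<Phi> t)
       + (b - a) * Re ((1 + \<Phi> t * cis (- y t)) / (1 - \<Phi> t * cis (- y t)))) (at t)"
proof -
  define E where "E = cis (y t)"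
  \<comment> \<open>The Moebius image of cis(y) is cis(y) (1 - q) / (1 - cnj q), whose argument is y
    + 2 arg(1 - q); this is the function being differentiated.\<close>
  define q where "q = \<Phi> t * cis (- y t)"
  have E: "cis (- y t) = inverse E" "E \<noteq> 0" by (simp_all add: E_def)
  have "norm q < 1" using \<Phi> by (simp add: q_def norm_mult disc_orbit_def)
  then have "Re q < 1" using complex_Re_le_cmod[of q] by linarith
  \<comment> \<open>The real part of 1 - q is positive, so the principal logarithm is differentiable
    there.\<close>
  then have q: "1 - q \<noteq> 0" "1 - q \<notin> \<real>\<^sub>\<le>\<^sub>0" by (auto simp: complex_nonpos_Reals_iff complex_eq_iff)
  have dy: "(y has_real_derivative \<nu> * sin (y t) + b + s * sin t) (at t)"
    using y by (auto simp: lifted_solution_def)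
  let ?y' = "\<nu> * sin (y t) + b + s * sin t"
  let ?\<Phi>' = "of_real (\<nu> / 2) * ((\<Phi> t)\<^sup>2 - 1) + \<i> * of_real (a + s * sin t) * \<Phi> t"
  define q' where "q' = \<Phi> t * (of_real (- ?y') * (\<i> * cis (- y t))) + ?\<Phi>' * cis (- y t)"
  have "((\<lambda>t. cis (- y t)) has_vector_derivative of_real (- ?y') * (\<i> * cis (- y t))) (at t)"
    using has_derivative_cis[OF DERIV_minus[OF dy, unfolded has_field_derivative_def]]
    by (simp add: has_vector_derivative_def scaleR_conv_of_real mult_ac)
  then have "((\<lambda>t. \<Phi> t * cis (- y t)) has_vector_derivative q') (at t)"
    unfolding q'_def using \<Phi> by (intro has_vector_derivative_mult) (auto simp: disc_orbit_def)
  then have "((\<lambda>t. 1 - \<Phi> t * cis (- y t)) has_vector_derivative - q') (at t)"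
    using has_vector_derivative_diff[OF has_vector_derivative_const, of _ _ _ 1] by simp
  from field_vector_diff_chain_at[OF this has_field_derivative_Ln]
  have "((\<lambda>t. Ln (1 - \<Phi> t * cis (- y t))) has_vector_derivative - q' * inverse (1 - q)) (at t)"
    using q(2) unfolding q_def o_def by blast
  then have "((\<lambda>t. Im (Ln (1 - \<Phi> t * cis (- y t)))) has_vector_derivative Im (- q' * inverse (1 - q))) (at t)"
    by (rule bounded_linear.has_vector_derivative[OF bounded_linear_Im])
  then have dIm: "((\<lambda>t. Im (Ln (1 - \<Phi> t * cis (- y t)))) has_real_derivative Im (- q' * inverse (1 - q))) (at t)"
    unfolding has_real_derivative_iff_has_vector_derivative .
  have main: "((\<lambda>t. y t + 2 * Im (Ln (1 - \<Phi> t * cis (- y t)))) has_real_derivative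
     ?y' + 2 * Im (- q' * inverse (1 - q))) (at t)"
    by (rule DERIV_add[OF dy DERIV_cmult[OF dIm]])
  have \<Phi>q: "\<Phi> t = q * E" by (simp add: q_def E)
  have sin: "\<i> * of_real (sin (y t)) = (E - inverse E) / 2"
    unfolding E_def cis_inverse by (simp add: complex_eq_iff)
  have "q' = (of_real \<nu> / 2) * (q\<^sup>2 * E - inverse E) - \<i> * of_real (b - a) * q
       - of_real \<nu> * (\<i> * of_real (sin (y t))) * q"
    unfolding q'_def E(1) \<Phi>q using E(2) by (simp add: field_simps power2_eq_square)
  also have "\<dots> = (of_real \<nu> / 2) * (q * E + inverse E) * (q - 1) - \<i> * of_real (b - a) * q"
    unfolding sin by (simp add: diff_divide_distrib add_divide_distrib algebra_simps power2_eq_square)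
  finally have "- q' = (of_real \<nu> / 2) * (q * E + inverse E) * (1 - q) + \<i> * of_real (b - a) * q"
    by (simp add: right_diff_distrib)
  moreover have "(X * (1 - q) + Y * q) * inverse (1 - q) = X + Y * (q / (1 - q))" for X Y
    using q(1) by (simp add: field_simps)
  ultimately have "- q' * inverse (1 - q) = (of_real \<nu> / 2) * (q * E + inverse E) + \<i> * of_real (b - a) * (q / (1 - q))"
    by (simp only:)
  then have Im: "Im (- q' * inverse (1 - q)) =
      Im ((of_real \<nu> / 2) * (q * E + inverse E) + \<i> * of_real (b - a) * (q / (1 - q)))"
    by (rule arg_cong)
  have "inverse E = cis (- y t)" by (simp add: E(1))
  then have "Im ((of_real \<nu> / 2) * (q * E + inverse E) + \<i> * of_real (b - a) * z) =
      \<nu> / 2 * (Im (\<Phi> t) - sin (y t)) + (b - a) * Re z" for z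
    by (simp only: \<Phi>q) simp
  note Im = Im[unfolded this]
  have "(1 + q) / (1 - q) = 1 + 2 * (q / (1 - q))" using q(1) by (simp add: field_simps)
  moreover have "Re (1 + 2 * z) = 1 + 2 * Re z" for z by simp
  ultimately have "Re ((1 + q) / (1 - q)) = 1 + 2 * Re (q / (1 - q))" by (simp only:)
  moreover have "?y' + 2 * (\<nu> / 2 * (A - sin (y t)) + (b - a) * B) =
      a + s * sin t + \<nu> * A + (b - a) * (1 + 2 * B)" for A B
    by (simp add: field_simps)
  ultimately have "?y' + 2 * Im (- q' * inverse (1 - q)) =
      a + s * sin t + \<nu> * Im (\<Phi> t) + (b - a) * Re ((1 + q) / (1 - q))"
    unfolding Im by (simp only:)
  with main show ?thesis unfolding q_def by (simp only:)
qed

text \<open>For \<open>b = a\<close> the derivative of the angle does not involve the solution, so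
  all angles advance equally over a period. For \<open>b > a\<close> the Poisson kernel adds a
  surplus. The angle stays within 2 pi of the identity because \<open>Im (Ln _)\<close> is at most
  pi in modulus.\<close>

lemma disc_orbit_conjugacy:
  assumes \<Phi>: "disc_orbit \<nu> a s \<Phi>"
  obtains \<phi> :: "real \<Rightarrow> real" and \<rho> where "\<And>x. \<bar>\<phi> x - x\<bar> \<le> 2 * pi"
    and "\<And>x. \<phi> (period_map \<nu> a s x) = \<phi> x + 2 * pi * \<rho>"
    and "\<And>b. a < b \<Longrightarrow> \<exists>\<kappa>>0. \<forall>x. \<phi> x + 2 * pi * (\<rho> + \<kappa>) \<le> \<phi> (period_map \<nu> b s x)"
proof -
  define \<phi> where "\<phi> x = x + 2 * Im (Ln (1 - \<Phi> 0 * cis (- x)))" for x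
  have cont: "continuous_on A \<Phi>" for A
    by (rule continuous_on_vector_derivative[of A]) (use \<Phi> in \<open>auto simp: disc_orbit_def intro: has_vector_derivative_at_within\<close>)
  have "continuous_on UNIV (\<lambda>t. a + s * sin t + \<nu> * Im (\<Phi> t))"
    by (intro continuous_intros cont)
  then obtain H where "H 0 = 0" "\<And>t. (H has_vector_derivative a + s * sin t + \<nu> * Im (\<Phi> t)) (at t)"
    using continuous_antiderivative by blast
  then have H: "H 0 = 0" "\<And>t. (H has_real_derivative a + s * sin t + \<nu> * Im (\<Phi> t)) (at t)"
    unfolding has_real_derivative_iff_has_vector_derivative by auto
  define \<rho> where "\<rho> = H (2 * pi) / (2 * pi)"
  have H': "H (2 * pi) = 2 * pi * \<rho>" by (simp add: \<rho>_def)
  define \<psi> where "\<psi> b x t = flow \<nu> b s x t + 2 * Im (Ln (1 - \<Phi> t * cis (- flow \<nu> b s x t)))" for b x t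
  have \<psi>0: "\<psi> b x 0 = \<phi> x" for b x by (simp add: \<psi>_def \<phi>_def)
  have \<psi>1: "\<psi> b x (2 * pi) = \<phi> (period_map \<nu> b s x)" for b x
    using \<Phi> by (simp add: \<psi>_def \<phi>_def period_map_def disc_orbit_def)
  have d\<psi>: "(\<psi> b x has_real_derivative a + s * sin t + \<nu> * Im (\<Phi> t)
       + (b - a) * Re ((1 + \<Phi> t * cis (- flow \<nu> b s x t)) / (1 - \<Phi> t * cis (- flow \<nu> b s x t)))) (at t)" for b x t
    unfolding \<psi>_def by (rule disc_orbit_angle[OF \<Phi> flow_solution])
  have norm: "norm (\<Phi> t) < 1" for t using \<Phi> by (simp add: disc_orbit_def)
  show thesis
  proof (rule that)
    show "\<bar>\<phi> x - x\<bar> \<le> 2 * pi" for x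
    proof -
      have "norm (\<Phi> 0 * cis (- x)) < 1" using norm by (simp add: norm_mult)
      then have "1 - \<Phi> 0 * cis (- x) \<noteq> 0" by auto
      then show ?thesis
        using mpi_less_Im_Ln[of "1 - \<Phi> 0 * cis (- x)"] Im_Ln_le_pi[of "1 - \<Phi> 0 * cis (- x)"]
        by (simp add: \<phi>_def)
    qed
    show "\<phi> (period_map \<nu> a s x) = \<phi> x + 2 * pi * \<rho>" for x
    proof -
      have "((\<lambda>t. \<psi> a x t - H t) has_real_derivative 0) (at t)" for t
        using DERIV_diff[OF d\<psi>[of a x t] H(2)[of t]] by simp
      then have "\<psi> a x (2 * pi) - H (2 * pi) = \<psi> a x 0 - H 0"
        by (intro DERIV_isconst_all allI)
      then show ?thesis by (simp add: \<psi>0 \<psi>1 H(1) H')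
    qed
    fix b assume "a < b"
    \<comment> \<open>By compactness of one period the orbit keeps a positive distance from the
      circle, so the surplus speed has a lower bound independent of the starting point.\<close>
    have "\<exists>\<tau>\<in>{0..2*pi}. \<forall>t\<in>{0..2*pi}. (1 - (norm (\<Phi> \<tau>))\<^sup>2) / 4 \<le> (1 - (norm (\<Phi> t))\<^sup>2) / 4"
      by (rule continuous_attains_inf) (auto intro!: continuous_intros cont)
    then obtain \<tau> where \<tau>: "\<And>t. t \<in> {0..2 * pi} \<Longrightarrow>
        (1 - (norm (\<Phi> \<tau>))\<^sup>2) / 4 \<le> (1 - (norm (\<Phi> t))\<^sup>2) / 4" by blast
    define m where "m = (1 - (norm (\<Phi> \<tau>))\<^sup>2) / 4"
    have "(norm (\<Phi> \<tau>))\<^sup>2 < 1" using norm[of \<tau>] by (simp add: power_less_one_iff)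
    then have m: "m > 0" by (simp add: m_def)
    show "\<exists>\<kappa>>0. \<forall>x. \<phi> x + 2 * pi * (\<rho> + \<kappa>) \<le> \<phi> (period_map \<nu> b s x)"
    proof (intro exI[of _ "(b - a) * m"] conjI allI)
      show "0 < (b - a) * m" using \<open>a < b\<close> m by simp
      fix x
      define R where "R t = Re ((1 + \<Phi> t * cis (- flow \<nu> b s x t)) / (1 - \<Phi> t * cis (- flow \<nu> b s x t)))" for t
      have R: "m \<le> R t" if "t \<in> {0..2*pi}" for t
      proof -
        have eq: "norm (\<Phi> t * cis (- flow \<nu> b s x t)) = norm (\<Phi> t)" by (simp add: norm_mult)
        have "(1 - (norm (\<Phi> t))\<^sup>2) / 4 \<le> R t"
          using Re_cayley_lower_bound[of "\<Phi> t * cis (- flow \<nu> b s x t)"] norm[of t]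
          unfolding eq R_def by blast
        with \<tau>[OF that] show ?thesis unfolding m_def by linarith
      qed
      have "\<psi> b x 0 - H 0 - (b - a) * m * 0 \<le> \<psi> b x (2 * pi) - H (2 * pi) - (b - a) * m * (2 * pi)"
      proof (rule DERIV_nonneg_imp_nondecreasing[of 0 "2 * pi"])
        fix t assume t: "0 \<le> t" "t \<le> 2 * pi"
        have "((\<lambda>t. \<psi> b x t - H t - (b - a) * m * t) has_real_derivative
            a + s * sin t + \<nu> * Im (\<Phi> t) + (b - a) * R t - (a + s * sin t + \<nu> * Im (\<Phi> t)) - (b - a) * m * 1) (at t)"
          unfolding R_def by (intro derivative_intros d\<psi> H(2)) (auto intro!: derivative_eq_intros)
        moreover have "0 \<le> a + s * sin t + \<nu> * Im (\<Phi> t) + (b - a) * R t - (a + s * sin t + \<nu> * Im (\<Phi> t)) - (b - a) * m * 1"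
          using R[of t] t \<open>a < b\<close> by simp
        ultimately show "\<exists>d. ((\<lambda>t. \<psi> b x t - H t - (b - a) * m * t) has_real_derivative d) (at t) \<and> 0 \<le> d"
          by blast
      qed simp
      then show "\<phi> x + 2 * pi * (\<rho> + (b - a) * m) \<le> \<phi> (period_map \<nu> b s x)"
        unfolding \<psi>0 \<psi>1 H(1) H' by (simp add: algebra_simps)
    qed
  qed
qed

lemma semiconj_iterate_ge:
  fixes \<phi> h :: "real \<Rightarrow> real"
  assumes "\<And>x. \<phi> x + c \<le> \<phi> (h x)"
  shows "\<phi> x + real n * c \<le> \<phi> ((h ^^ n) x)"
proof (induction n)
  case (Suc n)
  then show ?case using assms[of "(h ^^ n) x"] by (simp add: algebra_simps)
qed simp

lemma rotation_number_disc_orbit: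
  assumes conj: "\<And>x. \<phi> (period_map \<nu> a s x) = \<phi> x + 2 * pi * \<rho>"
    and B: "\<And>x. \<bar>\<phi> x - x\<bar> \<le> B" and x: "lifted_solution \<nu> a s x"
  shows "(\<lambda>n. (x (2 * pi * real n) - x 0) / (2 * pi * real n)) \<longlonglongrightarrow> \<rho>"
proof (rule rotation_tendsto[OF x])
  fix n
  have "\<phi> ((period_map \<nu> a s ^^ n) (x 0)) = \<phi> (x 0) + 2 * pi * \<rho> * real n"
    by (induction n) (simp_all add: conj algebra_simps)
  then show "\<bar>(period_map \<nu> a s ^^ n) (x 0) - x 0 - 2 * pi * \<rho> * real n\<bar> \<le> 2 * B"
    using B[of "(period_map \<nu> a s ^^ n) (x 0)"] B[of "x 0"] by linarith
qed

text \<open>This justifies the definite description in \<open>rotation_number\<close>: both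
  alternatives provide a limit common to all solutions.\<close>

lemma rotation_number_tendsto:
  assumes "lifted_solution \<nu> a s x"
  shows "(\<lambda>n. (x (2 * pi * real n) - x 0) / (2 * pi * real n)) \<longlonglongrightarrow> rotation_number \<nu> a s"
proof -
  have "\<exists>\<rho>. \<forall>x. lifted_solution \<nu> a s x \<longrightarrow>
     (\<lambda>n. (x (2 * pi * real n) - x 0) / (2 * pi * real n)) \<longlonglongrightarrow> \<rho>"
  proof (cases rule: fixed_point_or_disc_orbit[of \<nu> a s])
    case (fixed y k)
    then show ?thesis using rotation_number_fixed_point by blast
  next
    case (disc \<Phi>)
    then obtain \<phi> \<rho> where "\<And>x. \<bar>\<phi> x - x\<bar> \<le> 2 * pi" "\<And>x. \<phi> (period_map \<nu> a s x) = \<phi> x + 2 * pi * \<rho>"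
      by (rule disc_orbit_conjugacy) blast
    then show ?thesis using rotation_number_disc_orbit[of \<phi> \<nu> a s \<rho> "2 * pi"] by blast
  qed
  then show ?thesis using rotation_number_unique assms by blast
qed

lemma rotation_number_eq_fixed_point:
  "period_map \<nu> a s y = y + 2 * pi * real_of_int k \<Longrightarrow> rotation_number \<nu> a s = real_of_int k"
  by (rule rotation_number_unique) (rule rotation_number_fixed_point)

lemma linear_growth_limit:
  fixes u :: "nat \<Rightarrow> real"
  assumes "(\<lambda>n. u n / (2 * pi * real n)) \<longlonglongrightarrow> \<rho>" and low: "\<And>n. real n * (2 * pi * c) - B \<le> u n"
  shows "c \<le> \<rho>"
proof -
  have "(\<lambda>n. c - (B / (2 * pi)) / real n) \<longlonglongrightarrow> c - 0"
    by (intro tendsto_intros lim_const_over_n)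
  then have "(\<lambda>n. c - (B / (2 * pi)) / real n) \<longlonglongrightarrow> c" by simp
  moreover have "\<exists>N. \<forall>n\<ge>N. c - (B / (2 * pi)) / real n \<le> u n / (2 * pi * real n)"
  proof (intro exI[of _ 1] allI impI)
    fix n :: nat assume "1 \<le> n"
    then have "c - (B / (2 * pi)) / real n = (real n * (2 * pi * c) - B) / (2 * pi * real n)"
      by (simp add: field_simps)
    also have "\<dots> \<le> u n / (2 * pi * real n)"
      by (intro divide_right_mono low) auto
    finally show "c - (B / (2 * pi)) / real n \<le> u n / (2 * pi * real n)" .
  qed
  ultimately show ?thesis by (rule LIMSEQ_le[OF _ assms(1)])
qed

text \<open>Any function at bounded distance from the identity sees the same growth rate. The
  criterion is applied both to the identity and to the Moebius angle.\<close>

lemma rotation_number_ge: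
  assumes step: "\<And>x. \<phi> x + 2 * pi * c \<le> \<phi> (period_map \<nu> a s x)" and B: "\<And>x. \<bar>\<phi> x - x\<bar> \<le> B"
  shows "c \<le> rotation_number \<nu> a s"
proof (rule linear_growth_limit[OF rotation_number_tendsto[OF flow_solution]])
  fix n
  let ?y = "(period_map \<nu> a s ^^ n) 0"
  have "\<phi> 0 + real n * (2 * pi * c) \<le> \<phi> ?y"
    using semiconj_iterate_ge[of \<phi> "2 * pi * c" "period_map \<nu> a s" 0 n] step by simp
  then show "real n * (2 * pi * c) - 2 * B \<le> flow \<nu> a s 0 (2 * pi * real n) - flow \<nu> a s 0 0"
    using B[of ?y] B[of 0] unfolding lifted_solution_iterate[OF flow_solution] flow_0 by linarith
qed

lemma rotation_number_le:
  assumes step: "\<And>x. \<phi> (period_map \<nu> a s x) \<le> \<phi> x + 2 * pi * c" and B: "\<And>x. \<bar>\<phi> x - x\<bar> \<le> B"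
  shows "rotation_number \<nu> a s \<le> c"
proof -
  have "- c \<le> - rotation_number \<nu> a s"
  proof (rule linear_growth_limit)
    show "(\<lambda>n. (- (flow \<nu> a s 0 (2 * pi * real n) - flow \<nu> a s 0 0)) / (2 * pi * real n))
        \<longlonglongrightarrow> - rotation_number \<nu> a s"
      using tendsto_minus[OF rotation_number_tendsto[OF flow_solution, of \<nu> a s 0]] by simp
    fix n
    let ?y = "(period_map \<nu> a s ^^ n) 0"
    have "- \<phi> x + 2 * pi * - c \<le> - \<phi> (period_map \<nu> a s x)" for x
      using step[of x] by simp
    from semiconj_iterate_ge[of "\<lambda>x. - \<phi> x" "2 * pi * - c" "period_map \<nu> a s" 0 n, OF this]
    have "- \<phi> 0 + real n * (2 * pi * - c) \<le> - \<phi> ?y" .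
    then show "real n * (2 * pi * - c) - 2 * B \<le> - (flow \<nu> a s 0 (2 * pi * real n) - flow \<nu> a s 0 0)"
      using B[of ?y] B[of 0] unfolding lifted_solution_iterate[OF flow_solution] flow_0 by linarith
  qed
  then show ?thesis by simp
qed

lemma rotation_number_less_of_disc_orbit:
  assumes \<Phi>: "disc_orbit \<nu> a s \<Phi>" and "a < b"
  shows "rotation_number \<nu> a s < rotation_number \<nu> b s"
proof -
  obtain \<phi> \<rho> where \<phi>: "\<And>x. \<bar>\<phi> x - x\<bar> \<le> 2 * pi"
    "\<And>x. \<phi> (period_map \<nu> a s x) = \<phi> x + 2 * pi * \<rho>"
    "\<exists>\<kappa>>0. \<forall>x. \<phi> x + 2 * pi * (\<rho> + \<kappa>) \<le> \<phi> (period_map \<nu> b s x)"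
    using disc_orbit_conjugacy[OF \<Phi>] \<open>a < b\<close> by metis
  then obtain \<kappa> where \<kappa>: "\<kappa> > 0" "\<And>x. \<phi> x + 2 * pi * (\<rho> + \<kappa>) \<le> \<phi> (period_map \<nu> b s x)"
    by blast
  have "rotation_number \<nu> a s \<le> \<rho>" using \<phi> by (intro rotation_number_le[of \<phi>]) auto
  moreover have "\<rho> + \<kappa> \<le> rotation_number \<nu> b s" using \<kappa> \<phi>(1) by (intro rotation_number_ge[of \<phi>]) auto
  ultimately show ?thesis using \<kappa>(1) by linarith
qed

text \<open>The forcing integrates to 0 over a period, so only the term nu sin x separates the mean
  speed from \<open>a\<close>. This makes the slices of a tongue bounded and decides the case of
  |nu| at most 1.\<close>

lemma rotation_number_close: "\<bar>rotation_number \<nu> a s - a\<bar> \<le> \<bar>\<nu>\<bar>"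
proof -
  have est: "\<bar>period_map \<nu> a s x - x - 2 * pi * a\<bar> \<le> 2 * pi * \<bar>\<nu>\<bar>" for x
  proof -
    let ?u = "\<lambda>t. flow \<nu> a s x t - a * t + s * cos t"
    have "norm (?u (2 * pi) - ?u 0) \<le> \<bar>\<nu>\<bar> * norm (2 * pi - 0)"
    proof (rule field_differentiable_bound[of UNIV])
      fix t :: real
      have "(flow \<nu> a s x has_real_derivative \<nu> * sin (flow \<nu> a s x t) + a + s * sin t) (at t)"
        using flow_solution[of \<nu> a s x] by (auto simp: lifted_solution_def)
      then have "(?u has_real_derivative \<nu> * sin (flow \<nu> a s x t)) (at t)"
        by (auto intro!: derivative_eq_intros)
      then show "(?u has_real_derivative \<nu> * sin (flow \<nu> a s x t)) (at t within UNIV)" by simp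
      show "norm (\<nu> * sin (flow \<nu> a s x t)) \<le> \<bar>\<nu>\<bar>"
        by (simp add: abs_mult mult_left_le)
    qed auto
    then show ?thesis by (simp add: period_map_def mult_ac)
  qed
  have "a - \<bar>\<nu>\<bar> \<le> rotation_number \<nu> a s"
    by (rule rotation_number_ge[of "\<lambda>x. x" _ _ _ _ 0]) (use est in \<open>auto simp: abs_le_iff algebra_simps\<close>)
  moreover have "rotation_number \<nu> a s \<le> a + \<bar>\<nu>\<bar>"
    by (rule rotation_number_le[of "\<lambda>x. x" _ _ _ _ 0]) (use est in \<open>auto simp: abs_le_iff algebra_simps\<close>)
  ultimately show ?thesis by linarith
qed

text \<open>A displacement \<open>g\<close> of constant strict sign would, being continuous and
  periodic, stay away from 0 by a fixed amount, and the rotation number would differ from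
  \<open>r\<close>. The intermediate value theorem gives the zero.\<close>

lemma fixed_point_of_integer_rotation_number:
  assumes "rotation_number \<nu> a s = real_of_int r"
  obtains x where "period_map \<nu> a s x = x + 2 * pi * real_of_int r"
proof -
  define g where "g x = period_map \<nu> a s x - x - 2 * pi * real_of_int r" for x
  have cont: "continuous_on A g" for A
    unfolding g_def by (intro continuous_intros continuous_on_subset[OF continuous_period_map]) auto
  have per: "\<exists>y\<in>{0..2*pi}. g x = g y" for x
  proof -
    obtain k where "x - 2 * pi * real_of_int k \<in> {0..0 + 2 * pi}" by (rule reduce_mod_2pi)
    then have "x - 2 * pi * real_of_int k \<in> {0..2*pi}" by simp
    moreover have "g x = g (x - 2 * pi * real_of_int k)"
      using flow_add[of \<nu> a s "x - 2 * pi * real_of_int k" k "2 * pi"]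
      by (simp add: g_def period_map_def)
    ultimately show ?thesis by blast
  qed
  have "\<exists>x. g x \<le> 0"
  proof (rule ccontr)
    assume "\<not> (\<exists>x. g x \<le> 0)"
    then have pos: "g x > 0" for x by (meson not_le)
    have "\<exists>m\<in>{0..2*pi}. \<forall>x\<in>{0..2*pi}. g m \<le> g x"
      by (rule continuous_attains_inf) (auto intro: cont)
    then obtain m where m: "\<And>x. x \<in> {0..2*pi} \<Longrightarrow> g m \<le> g x" by blast
    have "real_of_int r + g m / (2 * pi) \<le> rotation_number \<nu> a s"
    proof (rule rotation_number_ge[of "\<lambda>x. x" _ _ _ _ 0])
      fix x
      show "x + 2 * pi * (real_of_int r + g m / (2 * pi)) \<le> period_map \<nu> a s x"
      proof -
        obtain y where "y \<in> {0..2*pi}" "g x = g y" using per by blast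
        then have "g m \<le> period_map \<nu> a s x - x - 2 * pi * real_of_int r"
          using m g_def by metis
        then show ?thesis by (simp add: distrib_left)
      qed
    qed simp
    then show False using assms pos[of m] by (simp add: field_simps)
  qed
  moreover have "\<exists>x. 0 \<le> g x"
  proof (rule ccontr)
    assume "\<not> (\<exists>x. 0 \<le> g x)"
    then have neg: "g x < 0" for x by (meson not_le)
    have "\<exists>m\<in>{0..2*pi}. \<forall>x\<in>{0..2*pi}. g x \<le> g m"
      by (rule continuous_attains_sup) (auto intro: cont)
    then obtain m where m: "\<And>x. x \<in> {0..2*pi} \<Longrightarrow> g x \<le> g m" by blast
    have "rotation_number \<nu> a s \<le> real_of_int r + g m / (2 * pi)"
    proof (rule rotation_number_le[of "\<lambda>x. x" _ _ _ _ 0])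
      fix x
      show "period_map \<nu> a s x \<le> x + 2 * pi * (real_of_int r + g m / (2 * pi))"
      proof -
        obtain y where "y \<in> {0..2*pi}" "g x = g y" using per by blast
        then have "period_map \<nu> a s x - x - 2 * pi * real_of_int r \<le> g m"
          using m g_def by metis
        then show ?thesis by (simp add: distrib_left)
      qed
    qed simp
    then show False using assms neg[of m] by (simp add: field_simps)
  qed
  ultimately obtain x y where xy: "g x \<le> 0" "0 \<le> g y" by blast
  have "\<exists>z. g z = 0"
  proof (cases "x \<le> y")
    case True
    then show ?thesis using IVT'[of g x 0 y] xy cont by blast
  next
    case False
    then show ?thesis using IVT2'[of g x 0 y] xy cont by auto
  qed
  then obtain z where "g z = 0" by blast
  then have "period_map \<nu> a s z = z + 2 * pi * real_of_int r" unfolding g_def by linarith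
  then show ?thesis by (rule that)
qed

section \<open>Tongues and adjacencies\<close>

lemma arnold_tongue_integer:
  assumes "is_arnold_tongue \<nu> r"
  obtains k where "r = real_of_int k"
proof -
  from assms obtain p e where e: "e > 0" "ball p e \<subseteq> rotation_level_set \<nu> r"
    unfolding is_arnold_tongue_def by (meson equals0I mem_interior)
  obtain a s where p: "p = (a, s)" by force
  define b where "b = a + e / 2"
  have "(a, s) \<in> ball p e" "(b, s) \<in> ball p e"
    using e(1) by (auto simp: p b_def dist_Pair_Pair dist_real_def)
  then have *: "rotation_number \<nu> a s = r" "rotation_number \<nu> b s = r"
    using e(2) by (auto simp: rotation_level_set_def)
  show ?thesis
  proof (cases rule: fixed_point_or_disc_orbit[of \<nu> a s])
    case (fixed x k)
    then show ?thesis using rotation_number_eq_fixed_point * that by metis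
  next
    case (disc \<Phi>)
    then have "rotation_number \<nu> a s < rotation_number \<nu> b s"
      by (rule rotation_number_less_of_disc_orbit) (use e(1) in \<open>simp add: b_def\<close>)
    then show ?thesis using * by simp
  qed
qed

lemma adjacency_unique_abscissa:
  assumes "is_adjacency \<nu> r (a, s)" and "rotation_number \<nu> b s = r"
  shows "b = a"
proof -
  let ?S = "{a. (a, s) \<in> rotation_level_set \<nu> r}"
  \<comment> \<open>Boundedness of the slice is what gives \<open>Inf\<close> and \<open>Sup\<close>
    their order-theoretic meaning over the reals.\<close>
  have "?S \<subseteq> {r - \<bar>\<nu>\<bar>..r + \<bar>\<nu>\<bar>}"
  proof
    fix c assume "c \<in> ?S"
    then show "c \<in> {r - \<bar>\<nu>\<bar>..r + \<bar>\<nu>\<bar>}"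
      using rotation_number_close[of \<nu> c s] by (auto simp: rotation_level_set_def)
  qed
  then have "bdd_below ?S" "bdd_above ?S"
    by (meson bdd_above_Icc bdd_above_mono bdd_below_Icc bdd_below_mono)+
  moreover have "b \<in> ?S" using assms(2) by (simp add: rotation_level_set_def)
  ultimately have "Inf ?S \<le> b" "b \<le> Sup ?S" by (auto intro: cInf_lower cSup_upper)
  moreover have "a = Inf ?S" "a = Sup ?S"
    using assms(1) by (auto simp: is_adjacency_def left_boundary_def right_boundary_def)
  ultimately show ?thesis by linarith
qed

text \<open>For \<open>b \<noteq> a\<close> the displacement \<open>g b\<close> has no zero, hence
  one sign, and monotonicity in the parameter makes it positive to the right of \<open>a\<close> and
  negative to the left. Continuity in the parameter squeezes \<open>g a\<close> to 0 at every
  point.\<close>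

lemma adjacency_period_map:
  assumes adj: "is_adjacency \<nu> (real_of_int r) (a, s)"
  shows "period_map \<nu> a s x = x + 2 * pi * real_of_int r"
proof -
  define g where "g b x = period_map \<nu> b s x - x - 2 * pi * real_of_int r" for b x
  have cont: "continuous_on A (g b)" for A b
    unfolding g_def by (intro continuous_intros continuous_on_subset[OF continuous_period_map]) auto
  have contb: "continuous_on UNIV (\<lambda>b. g b x)" for x
    unfolding g_def by (intro continuous_intros continuous_period_map_param)
  have "rotation_number \<nu> a s = real_of_int r"
    using adj by (auto simp: is_adjacency_def rotation_level_set_def)
  then obtain x0 where "period_map \<nu> a s x0 = x0 + 2 * pi * real_of_int r"
    by (rule fixed_point_of_integer_rotation_number)
  then have x0: "g a x0 = 0" by (simp add: g_def)
  have nz: "g b y \<noteq> 0" if "b \<noteq> a" for b y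
    using adjacency_unique_abscissa[OF adj] rotation_number_eq_fixed_point[of \<nu> b s y r] that
    by (auto simp: g_def)
  have same_sign: "g b y > 0 \<longleftrightarrow> g b z > 0" if "b \<noteq> a" for b y z
  proof (rule ccontr)
    assume "(g b y > 0) \<noteq> (g b z > 0)"
    then have "\<exists>u v. g b u \<le> 0 \<and> 0 \<le> g b v" by (meson not_less less_imp_le)
    then obtain u v where uv: "g b u \<le> 0" "0 \<le> g b v" by blast
    then have "\<exists>z. g b z = 0"
    proof (cases "u \<le> v")
      case True
      then show ?thesis using IVT'[of "g b" u 0 v] uv cont by blast
    next
      case False
      then show ?thesis using IVT2'[of "g b" u 0 v] uv cont by auto
    qed
    then show False using nz[OF that] by blast
  qed
  have up: "g b x > 0" if "b > a" for b
    using period_map_strict_mono[OF that, of \<nu> s x0] x0 same_sign[of b x0 x] that by (auto simp: g_def)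
  have down: "g b x < 0" if "b < a" for b
    using period_map_strict_mono[OF that, of \<nu> s x0] x0 same_sign[of b x0 x] nz[of b x] that
    by (auto simp: g_def)
  have lim: "((\<lambda>b. g b x) \<longlongrightarrow> g a x) (at a within A)" for A
    using contb[of x] by (auto simp: continuous_on_def intro: tendsto_within_subset)
  have "0 \<le> g a x"
    by (rule tendsto_lowerbound[OF lim[of "{a<..}"]]) (auto simp: eventually_at_filter dest: up intro!: always_eventually less_imp_le)
  moreover have "g a x \<le> 0"
    by (rule tendsto_upperbound[OF lim[of "{..<a}"]]) (auto simp: eventually_at_filter dest: down intro!: always_eventually less_imp_le)
  ultimately show ?thesis by (simp add: g_def)
qed

section \<open>Fourier series and winding numbers\<close>

text \<open>Uniform continuity in a form that can be integrated exactly against the kernel: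
  \<open>\<epsilon>\<close> covers the points near the diagonal, and away from it 1 - cos is bounded
  below.\<close>

lemma periodic_modulus:
  fixes f :: "real \<Rightarrow> complex"
  assumes cont: "continuous_on UNIV f" and per: "\<And>t. f (t + 2 * pi) = f t" and "\<epsilon> > 0"
  obtains C where "C \<ge> 0" and "\<And>t u. norm (f t - f u) \<le> \<epsilon> + C * (1 - cos (t - u))"
proof -
  \<comment> \<open>After reduction t lies in [0, 2 pi] and t - u in [-pi, pi], so this window
    contains both points.\<close>
  let ?I = "{- 2 * pi..4 * pi}"
  have contI: "continuous_on ?I f" by (rule continuous_on_subset[OF cont]) simp
  have "bounded (f ` ?I)"
    by (rule compact_imp_bounded[OF compact_continuous_image[OF contI]]) simp
  then obtain M where M: "\<And>t. t \<in> ?I \<Longrightarrow> norm (f t) \<le> M"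
    unfolding bounded_iff by blast
  have "norm (f 0) \<le> M" by (rule M) simp
  then have "M \<ge> 0" using norm_ge_zero[of "f 0"] by linarith
  have "uniformly_continuous_on ?I f" by (rule compact_uniformly_continuous[OF contI]) simp
  then obtain \<delta>0 where \<delta>0: "\<delta>0 > 0"
    "\<And>x y. x \<in> ?I \<Longrightarrow> y \<in> ?I \<Longrightarrow> dist y x < \<delta>0 \<Longrightarrow> dist (f y) (f x) < \<epsilon>"
    using \<open>\<epsilon> > 0\<close> unfolding uniformly_continuous_on_def by metis
  define \<delta> where "\<delta> = min \<delta>0 1"
  have \<delta>: "\<delta> > 0" "\<delta> \<le> \<delta>0" "\<delta> \<le> pi" using \<delta>0(1) pi_gt3 by (auto simp: \<delta>_def)
  have "cos \<delta> < cos 0" by (rule cos_monotone_0_pi) (use \<delta> in auto)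
  then have cos: "1 - cos \<delta> > 0" by simp
  define C where "C = 2 * M / (1 - cos \<delta>)"
  have C: "C \<ge> 0" using \<open>M \<ge> 0\<close> cos by (simp add: C_def)
  have "norm (f t - f u) \<le> \<epsilon> + C * (1 - cos (t - u))" for t u
  proof -
    obtain k where k: "t - 2 * pi * real_of_int k \<in> {0..0 + 2 * pi}" by (rule reduce_mod_2pi)
    obtain m where m: "(t - u) - 2 * pi * real_of_int m \<in> {- pi..- pi + 2 * pi}" by (rule reduce_mod_2pi)
    define t' where "t' = t - 2 * pi * real_of_int k"
    define \<theta> where "\<theta> = (t - u) - 2 * pi * real_of_int m"
    have ft: "f t = f t'" using periodic_shift_int[of f t' k, OF per] by (simp add: t'_def)
    have "u = (t' - \<theta>) + 2 * pi * real_of_int (k - m)" by (simp add: t'_def \<theta>_def algebra_simps)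
    then have fu: "f u = f (t' - \<theta>)" using periodic_shift_int[of f "t' - \<theta>" "k - m", OF per] by simp
    have "t - u = \<theta> + 2 * pi * real_of_int m" by (simp add: \<theta>_def)
    then have c: "cos (t - u) = cos \<theta>"
      using periodic_shift_int[of cos \<theta> m] by (simp add: cos_periodic)
    have t': "t' \<in> ?I" "t' - \<theta> \<in> ?I" using k m unfolding t'_def[symmetric] \<theta>_def[symmetric] by auto
    show ?thesis
    proof (cases "\<bar>\<theta>\<bar> < \<delta>")
      case True
      then have "dist t' (t' - \<theta>) < \<delta>0" using \<delta> by (simp add: dist_real_def)
      then have "norm (f t - f u) < \<epsilon>" using \<delta>0(2)[OF t'(2,1)] by (simp add: ft fu dist_norm)
      moreover have "0 \<le> C * (1 - cos (t - u))" using C by simp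
      ultimately show ?thesis by linarith
    next
      case False
      have "cos \<bar>\<theta>\<bar> \<le> cos \<delta>" using False \<delta> m by (intro cos_monotone_0_pi_le) (auto simp: \<theta>_def)
      then have "1 - cos \<delta> \<le> 1 - cos (t - u)" by (simp add: c)
      then have "C * (1 - cos \<delta>) \<le> C * (1 - cos (t - u))" using C by (rule mult_left_mono)
      moreover have "C * (1 - cos \<delta>) = 2 * M" using cos by (simp add: C_def)
      moreover have "norm (f t - f u) \<le> norm (f t) + norm (f u)" by (rule norm_triangle_ineq4)
      moreover have "norm (f t) \<le> M" "norm (f u) \<le> M" using M t' by (simp_all add: ft fu)
      ultimately show ?thesis using \<open>\<epsilon> > 0\<close> by linarith
    qed
  qed
  with C show ?thesis by (rule that)
qed

text \<open>The kernel \<open>((1 + cos \<theta>) / 2) ^ N\<close> is a nonnegative trigonometric polynomial concentrating at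
  \<open>\<theta> = 0\<close>; its integrals satisfy Wallis' recursion.\<close>

definition kernel_mass :: "nat \<Rightarrow> real" where
  "kernel_mass N = 2 * pi * (\<Prod>i<N. (2 * real i + 1) / (2 * real i + 2))"

lemma kernel_mass_pos: "kernel_mass N > 0"
  unfolding kernel_mass_def by (intro mult_pos_pos prod_pos) auto

text \<open>The difference of masses is the integral of (1 - cos)/2 against the kernel. Its ratio to
  the mass tends to 0, which is the concentration at 0 in quantitative form.\<close>

lemma kernel_mass_Suc: "kernel_mass N - kernel_mass (Suc N) = kernel_mass N / (2 * real N + 2)"
  unfolding kernel_mass_def by (simp add: field_simps)

lemma kernel_has_integral:
  "((\<lambda>u. ((1 + cos (t - u)) / 2) ^ N) has_integral kernel_mass N) {0..2 * pi}"
proof (induction N)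
  case 0
  show ?case using has_integral_const_real[of "1::real" 0 "2 * pi"] by (simp add: kernel_mass_def)
next
  case (Suc N)
  let ?q = "\<lambda>u. (1 + cos (t - u)) / 2"
  \<comment> \<open>Its derivative combines the kernels of orders \<open>N\<close> and
    \<open>Suc N\<close>; as \<open>?P\<close> is periodic, that combination integrates to
    0.\<close>
  let ?P = "\<lambda>u. ?q u ^ N * sin (t - u)"
  have der: "(?P has_real_derivative (2 * real N + 1) * ?q u ^ N - (2 * real N + 2) * ?q u ^ Suc N) (at u within A)" for u A
  proof -
    have "(?P has_real_derivative
       (real N * (sin (t - u) / 2 * ?q u ^ (N - Suc 0))) * sin (t - u) + ?q u ^ N * - cos (t - u)) (at u within A)"
      by (auto intro!: derivative_eq_intros)
    moreover have "(real N * (sin (t - u) / 2 * ?q u ^ (N - Suc 0))) * sin (t - u) + ?q u ^ N * - cos (t - u)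
        = (2 * real N + 1) * ?q u ^ N - (2 * real N + 2) * ?q u ^ Suc N"
    proof -
      define Q where "Q = ?q u"
      have c: "cos (t - u) = 2 * Q - 1" by (simp add: Q_def field_simps)
      have "(sin (t - u))\<^sup>2 = 1 - (cos (t - u))\<^sup>2" by (simp add: sin_squared_eq)
      then have s: "sin (t - u) * sin (t - u) = 4 * Q * (1 - Q)"
        by (simp add: c power2_eq_square algebra_simps)
      have "real N * Q ^ (N - Suc 0) * (sin (t - u) * sin (t - u)) = 4 * real N * Q ^ N * (1 - Q)"
      proof -
        have "real N * Q ^ (N - Suc 0) * Q = real N * Q ^ N" by (cases N) auto
        then show ?thesis unfolding s by (metis (no_types, opaque_lifting) mult.assoc mult.commute)
      qed
      then show ?thesis unfolding Q_def[symmetric] c by (simp add: algebra_simps)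
    qed
    ultimately show ?thesis by simp
  qed
  have "((\<lambda>u. (2 * real N + 1) * ?q u ^ N - (2 * real N + 2) * ?q u ^ Suc N) has_integral (?P (2 * pi) - ?P 0)) {0..2 * pi}"
    by (rule fundamental_theorem_of_calculus)
       (use der in \<open>auto simp: has_real_derivative_iff_has_vector_derivative[symmetric]\<close>)
  moreover have "?P (2 * pi) - ?P 0 = 0"
    by (simp add: sin_diff cos_diff)
  ultimately have "((\<lambda>u. (2 * real N + 1) * ?q u ^ N - (2 * real N + 2) * ?q u ^ Suc N) has_integral 0) {0..2 * pi}"
    by simp
  from has_integral_diff[OF has_integral_mult_right[OF Suc.IH, of "2 * real N + 1"] this]
  have "((\<lambda>u. (2 * real N + 2) * ?q u ^ Suc N) has_integral (2 * real N + 1) * kernel_mass N) {0..2 * pi}"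
    by simp
  from has_integral_mult_right[OF this, of "1 / (2 * real N + 2)"]
  have "((\<lambda>u. ?q u ^ Suc N) has_integral (2 * real N + 1) * kernel_mass N / (2 * real N + 2)) {0..2 * pi}"
    by (simp add: add_pos_nonneg del: power_Suc)
  moreover have "(2 * real N + 1) * kernel_mass N / (2 * real N + 2) = kernel_mass (Suc N)"
    using kernel_mass_Suc[of N] by (simp add: field_simps)
  ultimately show ?case by simp
qed

text \<open>Since (1 + cos x)/2 = ((1 + cis x)/2)^2 cis(-x), this is the binomial theorem for the
  exponent 2N, shifted by N frequencies.\<close>

lemma kernel_trigonometric:
  "complex_of_real (((1 + cos \<theta>) / 2) ^ N) =
     (\<Sum>j\<le>2 * N. of_nat ((2 * N) choose j) / 4 ^ N * cis ((real j - real N) * \<theta>))"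
proof -
  have half: "((1 + cis \<theta>) / 2)\<^sup>2 * cis (- \<theta>) = complex_of_real ((1 + cos \<theta>) / 2)"
  proof -
    have 1: "cis \<theta> * cis (- \<theta>) = 1" by (simp add: cis_mult)
    have "((1 + cis \<theta>) / 2)\<^sup>2 * cis (- \<theta>) = (cis (- \<theta>) + 2 * (cis \<theta> * cis (- \<theta>)) + cis \<theta> * (cis \<theta> * cis (- \<theta>))) / 4"
      by (simp add: field_simps power2_eq_square)
    also have "\<dots> = complex_of_real ((1 + cos \<theta>) / 2)"
      unfolding 1 by (simp add: complex_eq_iff field_simps)
    finally show ?thesis .
  qed
  have "complex_of_real (((1 + cos \<theta>) / 2) ^ N) = (((1 + cis \<theta>) / 2)\<^sup>2 * cis (- \<theta>)) ^ N"
    unfolding half by (simp only: of_real_power)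
  also have "\<dots> = (cis \<theta> + 1) ^ (2 * N) / 4 ^ N * cis (- (real N * \<theta>))"
    unfolding power_mult_distrib power_mult[symmetric] power_divide Complex.DeMoivre
    by (simp add: add.commute power_mult)
  also have "\<dots> = (\<Sum>j\<le>2 * N. of_nat ((2 * N) choose j) / 4 ^ N * cis ((real j - real N) * \<theta>))"
    unfolding binomial_ring sum_divide_distrib sum_distrib_right
  proof (rule sum.cong[OF refl])
    fix j
    have "cis ((real j - real N) * \<theta>) = cis \<theta> ^ j * cis (- (real N * \<theta>))"
      by (simp add: Complex.DeMoivre cis_mult algebra_simps)
    then show "of_nat (2 * N choose j) * cis \<theta> ^ j * 1 ^ (2 * N - j) / 4 ^ N * cis (- (real N * \<theta>)) =
         of_nat (2 * N choose j) / 4 ^ N * cis ((real j - real N) * \<theta>)"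
      by simp
  qed
  finally show ?thesis .
qed

text \<open>Unnormalised, and at an arbitrary real frequency: Floquet solutions are periodic only up to a
  multiplier, and their frequencies lie in a coset of \<open>\<int>\<close>.\<close>

definition fourier_coeff :: "(real \<Rightarrow> complex) \<Rightarrow> real \<Rightarrow> complex" where
  "fourier_coeff f \<kappa> = integral {0..2 * pi} (\<lambda>t. f t * cis (- (\<kappa> * t)))"

text \<open>Convolution with the normalised kernel. The coefficients of the approximant are
  multiples of those of \<open>f\<close>, so a frequency absent from \<open>f\<close> is absent from
  the approximant too; uniqueness and one-sided spectra both rest on this.\<close>

lemma fourier_approximation:
  fixes f :: "real \<Rightarrow> complex"
  assumes cont: "continuous_on UNIV f" and per: "\<And>t. f (t + 2 * pi) = f t" and "\<epsilon> > 0"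
  obtains N :: nat and b where
    "\<And>t. norm (f t - (\<Sum>j\<le>2 * N. b j * fourier_coeff f (real j - real N) * cis ((real j - real N) * t))) < \<epsilon>"
proof -
  obtain C where C: "C \<ge> 0" "\<And>t u. norm (f t - f u) \<le> \<epsilon> / 2 + C * (1 - cos (t - u))"
    using periodic_modulus[OF cont per, of "\<epsilon> / 2"] \<open>\<epsilon> > 0\<close> by auto
  obtain N :: nat where N: "real N > 2 * C / \<epsilon>" using reals_Archimedean2 by blast
  let ?q = "\<lambda>t u. ((1 + cos (t - u)) / 2) ^ N"
  define b where "b j = of_nat ((2 * N) choose j) / 4 ^ N / complex_of_real (kernel_mass N)" for j
  have int: "g integrable_on {0..2 * pi}" if "continuous_on UNIV g" for g :: "real \<Rightarrow> complex"
    by (intro integrable_continuous_real continuous_on_subset[OF that]) simp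
  have sum: "(\<Sum>j\<le>2 * N. b j * fourier_coeff f (real j - real N) * cis ((real j - real N) * t))
      = integral {0..2 * pi} (\<lambda>u. f u * of_real (?q t u)) / of_real (kernel_mass N)" for t
  proof -
    have "integral {0..2 * pi} (\<lambda>u. f u * of_real (?q t u)) =
        integral {0..2 * pi} (\<lambda>u. \<Sum>j\<le>2 * N. of_nat ((2 * N) choose j) / 4 ^ N * cis ((real j - real N) * t)
          * (f u * cis (- ((real j - real N) * u))))"
      unfolding kernel_trigonometric sum_distrib_left
      by (rule arg_cong[where f = "integral _"]) (simp add: fun_eq_iff algebra_simps cis_mult)
    also have "\<dots> = (\<Sum>j\<le>2 * N. of_nat ((2 * N) choose j) / 4 ^ N * cis ((real j - real N) * t)
          * fourier_coeff f (real j - real N))"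
      unfolding fourier_coeff_def
      by (subst integral_sum) (auto intro!: int continuous_intros cont simp: integral_mult_right)
    finally show ?thesis
      unfolding b_def by (simp add: sum_divide_distrib mult_ac)
  qed
  have "norm (f t - (\<Sum>j\<le>2 * N. b j * fourier_coeff f (real j - real N) * cis ((real j - real N) * t))) < \<epsilon>" for t
  proof -
    let ?K = "kernel_mass N"
    have q: "((\<lambda>u. complex_of_real (?q t u)) has_integral of_real ?K) {0..2 * pi}"
      using has_integral_linear[OF kernel_has_integral[of t N] bounded_linear_of_real] by (simp only: o_def)
    have fq: "((\<lambda>u. f u * of_real (?q t u)) has_integral integral {0..2 * pi} (\<lambda>u. f u * of_real (?q t u))) {0..2 * pi}"
      by (intro integrable_integral int continuous_intros cont) auto
    have diff: "((\<lambda>u. (f t - f u) * of_real (?q t u)) has_integral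
        (f t * of_real ?K - integral {0..2 * pi} (\<lambda>u. f u * of_real (?q t u)))) {0..2 * pi}"
      using has_integral_diff[OF has_integral_mult_right[OF q, of "f t"] fq] by (simp add: left_diff_distrib)
    \<comment> \<open>The identity (1 - cos)/2 q^N = q^N - q^(N+1), with q = (1 + cos)/2, turns the
      error bound into a difference of kernel masses.\<close>
    have maj: "((\<lambda>u. \<epsilon> / 2 * ?q t u + 2 * C * (?q t u - ((1 + cos (t - u)) / 2) ^ Suc N)) has_integral
        (\<epsilon> / 2 * ?K + 2 * C * (?K - kernel_mass (Suc N)))) {0..2 * pi}"
      by (intro has_integral_add has_integral_mult_right has_integral_diff kernel_has_integral)
    have "norm (f t * of_real ?K - integral {0..2 * pi} (\<lambda>u. f u * of_real (?q t u)))
        \<le> \<epsilon> / 2 * ?K + 2 * C * (?K - kernel_mass (Suc N))"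
    proof -
      have "norm ((f t - f u) * of_real (?q t u)) \<le> \<epsilon> / 2 * ?q t u + 2 * C * (?q t u - ((1 + cos (t - u)) / 2) ^ Suc N)" for u
      proof -
        have nn: "0 \<le> ?q t u" by (intro zero_le_power) (smt (verit) cos_ge_minus_one divide_nonneg_pos)
        have "norm ((f t - f u) * of_real (?q t u)) = norm (f t - f u) * ?q t u"
          by (simp only: norm_mult norm_of_real abs_of_nonneg[OF nn])
        also have "\<dots> \<le> (\<epsilon> / 2 + C * (1 - cos (t - u))) * ?q t u"
          by (intro mult_right_mono C nn)
        also have "\<dots> = \<epsilon> / 2 * ?q t u + 2 * C * (?q t u - (1 + cos (t - u)) / 2 * ?q t u)"
          by (simp add: field_simps)
        finally show ?thesis by simp
      qed
      then have "norm (integral {0..2 * pi} (\<lambda>u. (f t - f u) * of_real (?q t u)))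
          \<le> integral {0..2 * pi} (\<lambda>u. \<epsilon> / 2 * ?q t u + 2 * C * (?q t u - ((1 + cos (t - u)) / 2) ^ Suc N))"
        by (intro integral_norm_bound_integral has_integral_integrable[OF diff] has_integral_integrable[OF maj])
      then show ?thesis unfolding integral_unique[OF diff] integral_unique[OF maj] .
    qed
    also have "\<dots> = ?K * (\<epsilon> / 2 + C / (real N + 1))"
      unfolding kernel_mass_Suc by (simp add: field_simps)
    also have "\<dots> < ?K * \<epsilon>"
    proof (rule mult_strict_left_mono[OF _ kernel_mass_pos])
      have "C < \<epsilon> / 2 * real N" using N \<open>\<epsilon> > 0\<close> by (simp add: field_simps)
      then have "C < \<epsilon> / 2 * (real N + 1)" using \<open>\<epsilon> > 0\<close> by (simp add: distrib_left)
      then have "C / (real N + 1) < \<epsilon> / 2" by (simp add: pos_divide_less_eq)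
      then show "\<epsilon> / 2 + C / (real N + 1) < \<epsilon>" by linarith
    qed
    finally have "norm (f t * of_real ?K - integral {0..2 * pi} (\<lambda>u. f u * of_real (?q t u))) / ?K < \<epsilon>"
      using kernel_mass_pos[of N] by (simp add: pos_divide_less_eq mult.commute)
    moreover have "f t - integral {0..2 * pi} (\<lambda>u. f u * of_real (?q t u)) / of_real ?K =
        (f t * of_real ?K - integral {0..2 * pi} (\<lambda>u. f u * of_real (?q t u))) / of_real ?K"
      using kernel_mass_pos[of N] by (simp add: field_simps)
    ultimately show ?thesis unfolding sum using kernel_mass_pos[of N] by (simp add: norm_divide)
  qed
  then show ?thesis by (rule that)
qed

lemma fourier_coeff_zero_imp_zero:
  assumes "continuous_on UNIV f" and "\<And>t. f (t + 2 * pi) = f t"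
    and zero: "\<And>n::int. fourier_coeff f (of_int n) = 0"
  shows "f t = 0"
proof (rule ccontr)
  assume "f t \<noteq> 0"
  then have pos: "norm (f t) > 0" by simp
  obtain N :: nat and b where b: "\<And>t'. norm (f t' - (\<Sum>j\<le>2 * N. b j *
      fourier_coeff f (real j - real N) * cis ((real j - real N) * t'))) < norm (f t)"
    by (rule fourier_approximation[OF assms(1,2) pos]) blast
  have "fourier_coeff f (real j - real N) = 0" for j
    using zero[of "int j - int N"] by simp
  then show False using b[of t] by simp
qed

text \<open>The number \<open>w\<close> may be any real, and \<open>f\<close> need not be periodic: for periodic \<open>f\<close> this is the
  winding number.\<close>

definition winds :: "(real \<Rightarrow> complex) \<Rightarrow> real \<Rightarrow> bool" where
  "winds f w \<longleftrightarrow> (\<exists>g. continuous_on UNIV g \<and> (\<forall>t. f t = exp (g t)) \<and>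
     (\<forall>t. g (t + 2 * pi) = g t + 2 * of_real pi * \<i> * of_real w))"

section \<open>Winding numbers through continuous logarithms\<close>

lemma winds_unique:
  assumes "winds f w" "winds f w'"
  shows "w = w'"
proof -
  obtain g h where g: "continuous_on UNIV g" "\<And>t. f t = exp (g t)"
      "\<And>t. g (t + 2 * pi) = g t + 2 * of_real pi * \<i> * of_real w"
    and h: "continuous_on UNIV h" "\<And>t. f t = exp (h t)"
      "\<And>t. h (t + 2 * pi) = h t + 2 * of_real pi * \<i> * of_real w'"
    using assms unfolding winds_def by blast
  \<comment> \<open>The two logarithms differ by \<open>d\<close> multiples of 2 pi i. Being
    continuous and integer-valued, \<open>d\<close> is constant, yet over a period it grows by
    \<open>w - w'\<close>.\<close>
  define d where "d t = Im (g t - h t) / (2 * pi)" for t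
  have "d t \<in> \<int>" for t
  proof -
    obtain n :: int where "g t = h t + of_int (2 * n) * of_real pi * \<i>"
      using g(2)[of t] h(2)[of t] exp_eq[of "g t" "h t"] by auto
    then have "d t = real_of_int n" by (simp add: d_def)
    then show ?thesis by simp
  qed
  note int = this
  have "continuous_on UNIV d" unfolding d_def by (intro continuous_intros g h) auto
  with connected_UNIV have "d constant_on UNIV"
  proof (rule continuous_discrete_range_constant)
    fix x :: real
    show "\<exists>e>0. \<forall>y. y \<in> UNIV \<and> d y \<noteq> d x \<longrightarrow> e \<le> norm (d y - d x)"
    proof (intro exI[of _ 1] conjI allI impI)
      fix y assume "y \<in> UNIV \<and> d y \<noteq> d x"
      moreover have "d y - d x \<in> \<int>" using int int by (rule Ints_diff)
      ultimately show "1 \<le> norm (d y - d x)" by (simp add: Ints_nonzero_abs_ge1)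
    qed simp
  qed
  then have "d (0 + 2 * pi) = d 0" unfolding constant_on_def by auto
  then show ?thesis unfolding d_def g(3) h(3) by (simp add: field_simps)
qed

lemma winds_mult:
  assumes "winds f w" "winds f' w'"
  shows "winds (\<lambda>t. f t * f' t) (w + w')"
proof -
  obtain g h where g: "continuous_on UNIV g" "\<And>t. f t = exp (g t)"
      "\<And>t. g (t + 2 * pi) = g t + 2 * of_real pi * \<i> * of_real w"
    and h: "continuous_on UNIV h" "\<And>t. f' t = exp (h t)"
      "\<And>t. h (t + 2 * pi) = h t + 2 * of_real pi * \<i> * of_real w'"
    using assms unfolding winds_def by blast
  show ?thesis unfolding winds_def
    by (rule exI[of _ "\<lambda>t. g t + h t"])
       (use g h in \<open>auto intro!: continuous_intros simp: exp_add algebra_simps\<close>)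
qed

lemma winds_cis: "winds (\<lambda>t. cis (real n * t)) (real n)"
  unfolding winds_def
  by (rule exI[of _ "\<lambda>t. \<i> * of_real (real n * t)"])
     (auto intro!: continuous_intros simp: cis_conv_exp algebra_simps)

lemma winds_near_one:
  assumes "continuous_on UNIV h" "\<And>t. h (t + 2 * pi) = h t" "\<And>t. norm (h t - 1) < 1"
  shows "winds h 0"
proof -
  have Re: "Re (h t) > 0" for t
    using abs_Re_le_cmod[of "h t - 1"] assms(3)[of t] by simp
  have "h t \<notin> \<real>\<^sub>\<le>\<^sub>0" "h t \<noteq> 0" for t
    using Re[of t] by (auto simp: complex_nonpos_Reals_iff)
  then show ?thesis unfolding winds_def
    by (intro exI[of _ "\<lambda>t. Ln (h t)"]) (auto intro!: continuous_intros assms(1) simp: assms(2))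
qed

lemma winds_const: "c \<noteq> 0 \<Longrightarrow> winds (\<lambda>t. c) 0"
  unfolding winds_def by (intro exI[of _ "\<lambda>t. Ln c"]) auto

text \<open>Rouche's principle: the factor 1 + h/f stays in the right half-plane and has winding
  number 0.\<close>

lemma winds_dominated:
  assumes f: "winds f w" "continuous_on UNIV f" "\<And>t. f (t + 2 * pi) = f t"
    and h: "continuous_on UNIV h" "\<And>t. h (t + 2 * pi) = h t" "\<And>t. norm (h t) < norm (f t)"
  shows "winds (\<lambda>t. f t + h t) w"
proof -
  have nz: "f t \<noteq> 0" for t using h(3)[of t] by auto
  have "winds (\<lambda>t. 1 + h t / f t) 0"
  proof (rule winds_near_one)
    show "continuous_on UNIV (\<lambda>t. 1 + h t / f t)" by (intro continuous_intros f h) (use nz in auto)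
    show "norm (1 + h t / f t - 1) < 1" for t using h(3)[of t] nz[of t] by (simp add: norm_divide)
  qed (simp add: f h)
  from winds_mult[OF f(1) this] show ?thesis using nz by (simp add: distrib_left)
qed

text \<open>A polynomial case of the argument principle: splitting off one root at a time, a factor
  cis(t) - z winds once if z is inside the circle and not at all if it is outside.\<close>

lemma winds_poly_circle:
  assumes "\<And>t. poly p (cis t) \<noteq> 0"
  shows "\<exists>n::nat. winds (\<lambda>t. poly p (cis t)) (real n)"
  using assms
proof (induction "degree p" arbitrary: p rule: less_induct)
  case less
  show ?case
  proof (cases "degree p = 0")
    case True
    then obtain c where "p = [:c:]" by (rule degree_eq_zeroE)
    then show ?thesis using winds_const[of c] less.prems[of 0] by (intro exI[of _ 0]) simp
  next
    case False
    then have "\<not> constant (poly p)" by (simp add: constant_degree)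
    then obtain z where "poly p z = 0" using fundamental_theorem_of_algebra by blast
    then obtain q where pq: "p = [:- z, 1:] * q" by (metis poly_eq_0_iff_dvd dvdE)
    have eval: "poly p (cis t) = poly q (cis t) * (cis t - z)" for t by (simp add: pq algebra_simps)
    have "q \<noteq> 0" using less.prems[of 0] eval[of 0] by auto
    then have "degree q < degree p" unfolding pq by (subst degree_mult_eq) auto
    moreover have "poly q (cis t) \<noteq> 0" for t using less.prems[of t] eval[of t] by auto
    ultimately obtain n :: nat where n: "winds (\<lambda>t. poly q (cis t)) (real n)"
      using less.hyps by blast
    have "norm z \<noteq> 1"
    proof
      assume "norm z = 1"
      then have "z = cis (Arg z)" using rcis_cmod_Arg[of z] by (simp add: rcis_def)
      then show False using less.prems[of "Arg z"] eval[of "Arg z"] by auto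
    qed
    then consider "norm z < 1" | "norm z > 1" by linarith
    then have "\<exists>m::nat. winds (\<lambda>t. cis t - z) (real m)"
    proof cases
      case 1
      have "winds (\<lambda>t. cis (real 1 * t) + - z) (real 1)"
        by (rule winds_dominated[OF winds_cis])
           (use 1 in \<open>auto intro!: continuous_intros simp: complex_eq_iff\<close>)
      then show ?thesis by (intro exI[of _ 1]) simp
    next
      case 2
      then have "- z \<noteq> 0" by auto
      have "winds (\<lambda>t. - z + cis t) 0"
        by (rule winds_dominated[OF winds_const[OF \<open>- z \<noteq> 0\<close>]])
           (use 2 in \<open>auto intro!: continuous_intros simp: complex_eq_iff\<close>)
      then show ?thesis by (intro exI[of _ 0]) simp
    qed
    then obtain m :: nat where "winds (\<lambda>t. cis t - z) (real m)" by blast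
    from winds_mult[OF n this] show ?thesis unfolding eval by (intro exI[of _ "n + m"]) simp
  qed
qed

lemma winding_nonneg:
  assumes cont: "continuous_on UNIV f" and per: "\<And>t. f (t + 2 * pi) = f t" and w: "winds f w"
    and zero: "\<And>n::int. n < 0 \<Longrightarrow> fourier_coeff f (of_int n) = 0"
  shows "w \<ge> 0"
proof -
  have nz: "f t \<noteq> 0" for t using w unfolding winds_def by auto
  \<comment> \<open>The minimum modulus of \<open>f\<close>, positive because \<open>f\<close> is an
    exponential, is the tolerance for the approximation; it makes Rouche's principle applicable at
    every \<open>t\<close>.\<close>
  have "\<exists>\<tau>\<in>{0..2*pi}. \<forall>t\<in>{0..2*pi}. norm (f \<tau>) \<le> norm (f t)"
    by (rule continuous_attains_inf) (auto intro!: continuous_intros continuous_on_subset[OF cont])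
  then obtain \<tau> where \<tau>: "\<And>t. t \<in> {0..2*pi} \<Longrightarrow> norm (f \<tau>) \<le> norm (f t)" by blast
  have min: "norm (f \<tau>) \<le> norm (f t)" for t
  proof -
    obtain k where k: "t - 2 * pi * real_of_int k \<in> {0..0 + 2 * pi}" by (rule reduce_mod_2pi)
    have "f t = f (t - 2 * pi * real_of_int k)"
      using periodic_shift_int[of f "t - 2 * pi * real_of_int k" k, OF per] by simp
    then show ?thesis using \<tau>[of "t - 2 * pi * real_of_int k"] k by simp
  qed
  have pos: "norm (f \<tau>) > 0" using nz by simp
  obtain N :: nat and b where b: "\<And>t. norm (f t - (\<Sum>j\<le>2 * N. b j *
      fourier_coeff f (real j - real N) * cis ((real j - real N) * t))) < norm (f \<tau>)"
    by (rule fourier_approximation[OF cont per pos]) blast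
  \<comment> \<open>Only indices from \<open>N\<close> on are kept: the lower ones carry negative
    frequencies, whose coefficients vanish.\<close>
  define p where "p = (\<Sum>i\<le>N. monom (b (N + i) * fourier_coeff f (real i)) i)"
  have p: "poly p (cis t) = (\<Sum>j\<le>2 * N. b j * fourier_coeff f (real j - real N) * cis ((real j - real N) * t))" for t
  proof -
    have "(\<Sum>j\<le>2 * N. b j * fourier_coeff f (real j - real N) * cis ((real j - real N) * t))
        = (\<Sum>j\<in>{N..N + N}. b j * fourier_coeff f (real j - real N) * cis ((real j - real N) * t))"
    proof (rule sum.mono_neutral_right)
      show "\<forall>j\<in>{..2 * N} - {N..N + N}. b j * fourier_coeff f (real j - real N) * cis ((real j - real N) * t) = 0"
      proof
        fix j assume "j \<in> {..2 * N} - {N..N + N}"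
        then have "fourier_coeff f (of_int (int j - int N)) = 0" by (intro zero) auto
        then show "b j * fourier_coeff f (real j - real N) * cis ((real j - real N) * t) = 0" by simp
      qed
    qed auto
    also have "\<dots> = (\<Sum>i\<le>N. b (N + i) * fourier_coeff f (real i) * cis (real i * t))"
      using sum.shift_bounds_cl_nat_ivl[of "\<lambda>j. b j * fourier_coeff f (real j - real N) * cis ((real j - real N) * t)" 0 N N]
      by (simp add: atMost_atLeast0 add.commute)
    also have "\<dots> = poly p (cis t)"
      by (simp add: p_def poly_sum poly_monom Complex.DeMoivre)
    finally show ?thesis by simp
  qed
  have close: "norm (poly p (cis t) - f t) < norm (f t)" for t
    using b[of t] min[of t] unfolding p by (simp add: norm_minus_commute)
  have cis_per: "cis (t + 2 * pi) = cis t" for t using cis_periodic_int[of t 1] by simp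
  have "winds (\<lambda>t. f t + (poly p (cis t) - f t)) w"
    by (rule winds_dominated[OF w cont per])
       (use close per cis_per in \<open>auto intro!: continuous_intros cont\<close>)
  then have wp: "winds (\<lambda>t. poly p (cis t)) w" by simp
  have "poly p (cis t) \<noteq> 0" for t using close[of t] by auto
  then obtain n :: nat where "winds (\<lambda>t. poly p (cis t)) (real n)"
    using winds_poly_circle by blast
  then show ?thesis using winds_unique[OF wp] by simp
qed

section \<open>Trivial period maps\<close>

text \<open>Rouche's principle used backwards. In the application only the sum of two solutions
  comes with an explicit logarithm, whereas the winding number of the dominant one is
  wanted.\<close>

lemma winds_cancel_dominated:
  assumes fh: "winds (\<lambda>t. f t + h t) w"
    and cont: "continuous_on UNIV f" "continuous_on UNIV h"
    and per: "\<And>t. f (t + 2 * pi) = f t" "\<And>t. h (t + 2 * pi) = h t"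
    and less: "\<And>t. norm (h t) < norm (f t)"
  shows "winds f w"
proof -
  have nz: "f t \<noteq> 0" for t using less[of t] by auto
  have "winds (\<lambda>t. 1 + h t / f t) 0"
  proof (rule winds_near_one)
    show "continuous_on UNIV (\<lambda>t. 1 + h t / f t)" by (intro continuous_intros cont) (use nz in auto)
    show "norm (1 + h t / f t - 1) < 1" for t using less[of t] nz[of t] by (simp add: norm_divide)
  qed (simp add: per)
  then obtain g where g: "continuous_on UNIV g" "\<And>t. 1 + h t / f t = exp (g t)"
      "\<And>t. g (t + 2 * pi) = g t + 2 * of_real pi * \<i> * of_real 0"
    unfolding winds_def by blast
  have "winds (\<lambda>t. exp (- g t)) 0"
    unfolding winds_def by (rule exI[of _ "\<lambda>t. - g t"]) (use g in \<open>auto intro!: continuous_intros\<close>)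
  from winds_mult[OF fh this] have "winds (\<lambda>t. (f t + h t) * exp (- g t)) w" by simp
  moreover have "(f t + h t) * exp (- g t) = f t" for t
  proof -
    have "f t + h t = f t * exp (g t)" unfolding g(2)[symmetric] using nz[of t] by (simp add: distrib_left)
    then show ?thesis by (simp add: exp_minus)
  qed
  ultimately show ?thesis by simp
qed

section \<open>Fourier coefficients of solutions of the linear system\<close>

lemma fourier_coeff_combine:
  assumes "continuous_on UNIV f" "continuous_on UNIV g"
  shows "fourier_coeff (\<lambda>t. c * f t + d * g t) \<kappa> = c * fourier_coeff f \<kappa> + d * fourier_coeff g \<kappa>"
proof -
  have int: "(\<lambda>t. h t * cis (- (\<kappa> * t))) integrable_on {0..2 * pi}" if "continuous_on UNIV h" for h :: "real \<Rightarrow> complex"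
    by (intro integrable_continuous_real continuous_intros continuous_on_subset[OF that]) auto
  have "((\<lambda>t. c * (f t * cis (- (\<kappa> * t))) + d * (g t * cis (- (\<kappa> * t)))) has_integral
      c * fourier_coeff f \<kappa> + d * fourier_coeff g \<kappa>) {0..2 * pi}"
    unfolding fourier_coeff_def
    by (intro has_integral_add has_integral_mult_right integrable_integral int assms)
  then show ?thesis
    unfolding fourier_coeff_def by (intro integral_unique) (simp add: algebra_simps)
qed

lemma fourier_coeff_cis:
  "fourier_coeff (\<lambda>t. cis (\<eta> * t) * f t) \<kappa> = fourier_coeff f (\<kappa> - \<eta>)"
proof -
  have "cis (\<eta> * t) * f t * cis (- (\<kappa> * t)) = f t * cis (- ((\<kappa> - \<eta>) * t))" for t
  proof -
    have "cis (\<eta> * t) * cis (- (\<kappa> * t)) = cis (- ((\<kappa> - \<eta>) * t))"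
      by (simp add: cis_mult algebra_simps)
    then show ?thesis by (metis mult.assoc mult.commute)
  qed
  then show ?thesis unfolding fourier_coeff_def by (simp only:)
qed

text \<open>Integration by parts; the hypothesis on the endpoint values cancels the boundary terms
  and allows \<open>f\<close> to be periodic only up to a multiplier.\<close>

lemma fourier_coeff_derivative:
  assumes der: "\<And>t. (f has_vector_derivative f' t) (at t)" and cont: "continuous_on UNIV f'"
    and per: "f (2 * pi) * cis (- (\<kappa> * (2 * pi))) = f 0"
  shows "fourier_coeff f' \<kappa> = \<i> * of_real \<kappa> * fourier_coeff f \<kappa>"
proof -
  let ?e = "\<lambda>t. cis (- (\<kappa> * t))"
  have contf: "continuous_on UNIV f"
    by (rule continuous_on_vector_derivative) (use der in \<open>auto intro: has_vector_derivative_at_within\<close>)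
  have int: "(\<lambda>t. h t * ?e t) integrable_on {0..2 * pi}" if "continuous_on UNIV h" for h :: "real \<Rightarrow> complex"
    by (intro integrable_continuous_real continuous_intros continuous_on_subset[OF that]) auto
  have de: "(?e has_vector_derivative of_real (- \<kappa>) * (\<i> * ?e t)) (at t)" for t
    unfolding has_vector_derivative_def
    by (rule derivative_eq_intros refl)+ (simp add: fun_eq_iff scaleR_conv_of_real algebra_simps)
  have dfe: "((\<lambda>t. f t * ?e t) has_vector_derivative f t * (of_real (- \<kappa>) * (\<i> * ?e t)) + f' t * ?e t) (at t within A)" for t A
    by (rule has_vector_derivative_at_within[OF has_vector_derivative_mult[OF der de]])
  have "((\<lambda>t. f t * (of_real (- \<kappa>) * (\<i> * ?e t)) + f' t * ?e t) has_integral f (2 * pi) * ?e (2 * pi) - f 0 * ?e 0) {0..2 * pi}"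
    by (rule fundamental_theorem_of_calculus) (use dfe in auto)
  then have "((\<lambda>t. f' t * ?e t - (\<i> * of_real \<kappa>) * (f t * ?e t)) has_integral 0) {0..2 * pi}"
    using per by (simp add: algebra_simps)
  moreover have "((\<lambda>t. f' t * ?e t - (\<i> * of_real \<kappa>) * (f t * ?e t)) has_integral
      fourier_coeff f' \<kappa> - (\<i> * of_real \<kappa>) * fourier_coeff f \<kappa>) {0..2 * pi}"
    unfolding fourier_coeff_def
    by (intro has_integral_diff has_integral_mult_right integrable_integral int cont contf)
  ultimately have "fourier_coeff f' \<kappa> - (\<i> * of_real \<kappa>) * fourier_coeff f \<kappa> = 0"
    using has_integral_unique by blast
  then show ?thesis by simp
qed

text \<open>The coefficients of the derivative are bounded, so those of \<open>f\<close> are at most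
  of the order of the inverse frequency.\<close>

lemma fourier_coeff_tendsto_zero:
  assumes der: "\<And>t. (f has_vector_derivative f' t) (at t)" and cont: "continuous_on UNIV f'"
    and per: "\<And>n::nat. f (2 * pi) * cis (- ((\<kappa> + real n) * (2 * pi))) = f 0"
  shows "(\<lambda>n. fourier_coeff f (\<kappa> + real n)) \<longlonglongrightarrow> 0"
proof -
  have "bounded (f' ` {0..2 * pi})"
    by (rule compact_imp_bounded[OF compact_continuous_image[OF continuous_on_subset[OF cont]]]) auto
  then obtain M where M: "\<And>t. t \<in> {0..2 * pi} \<Longrightarrow> norm (f' t) \<le> M" unfolding bounded_iff by blast
  have bound: "norm (fourier_coeff f' \<eta>) \<le> M * (2 * pi)" for \<eta>
  proof -
    have "norm (integral {0..2 * pi} (\<lambda>t. f' t * cis (- (\<eta> * t)))) \<le> M * (2 * pi - 0)"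
      by (rule integral_bound)
         (use M in \<open>auto intro!: continuous_intros continuous_on_subset[OF cont] simp: norm_mult\<close>)
    then show ?thesis by (simp add: fourier_coeff_def)
  qed
  show ?thesis
  proof (rule Lim_null_comparison)
    show "(\<lambda>n. M * (2 * pi) / (\<kappa> + real n)) \<longlonglongrightarrow> 0"
      by (intro tendsto_divide_0[OF tendsto_const] filterlim_at_top_imp_at_infinity
          filterlim_tendsto_add_at_top[OF tendsto_const] filterlim_real_sequentially)
    obtain N :: nat where N: "real N > - \<kappa>" using reals_Archimedean2 by blast
    show "\<forall>\<^sub>F n in sequentially. norm (fourier_coeff f (\<kappa> + real n)) \<le> M * (2 * pi) / (\<kappa> + real n)"
      using eventually_ge_at_top[of N]
    proof eventually_elim
      case (elim n)
      then have "real N \<le> real n" by simp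
      then have pos: "\<kappa> + real n > 0" using N by linarith
      have "norm (fourier_coeff f' (\<kappa> + real n)) = \<bar>\<kappa> + real n\<bar> * norm (fourier_coeff f (\<kappa> + real n))"
        unfolding fourier_coeff_derivative[OF der cont per] norm_mult norm_of_real by simp
      then have "(\<kappa> + real n) * norm (fourier_coeff f (\<kappa> + real n)) \<le> M * (2 * pi)"
        using bound[of "\<kappa> + real n"] pos by simp
      then show ?case using pos by (simp add: pos_le_divide_eq mult.commute)
    qed
  qed
qed

text \<open>For a Floquet solution with exponent \<open>\<mu>\<close>, the Fourier coefficients of the second
  component satisfy a three-term recurrence on \<open>\<mu> + \<int>\<close>.\<close>

lemma linear_solution_fourier:
  assumes lin: "linear_solution \<nu> a s v w"
    and per: "v (2 * pi) * cis (- (\<kappa> * (2 * pi))) = v 0" "w (2 * pi) * cis (- (\<kappa> * (2 * pi))) = w 0"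
  shows "\<i> * of_real \<kappa> * fourier_coeff v \<kappa> = - (of_real \<nu> / 2) * fourier_coeff w \<kappa>"
    and "\<i> * of_real \<kappa> * fourier_coeff w \<kappa> = - (of_real \<nu> / 2) * fourier_coeff v \<kappa>
      + \<i> * of_real a * fourier_coeff w \<kappa>
      + of_real s / 2 * (fourier_coeff w (\<kappa> - 1) - fourier_coeff w (\<kappa> + 1))"
proof -
  note cont = linear_solution_continuous[OF lin, of UNIV]
  have "\<i> * of_real \<kappa> * fourier_coeff v \<kappa> = fourier_coeff (\<lambda>t. - (of_real \<nu> / 2) * w t) \<kappa>"
    by (rule fourier_coeff_derivative[symmetric, OF linear_solutionD(1)[OF lin, of _ UNIV] _ per(1)])
       (intro continuous_intros cont)
  also have "\<dots> = fourier_coeff (\<lambda>t. - (of_real \<nu> / 2) * w t + 0 * w t) \<kappa>" by simp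
  finally show "\<i> * of_real \<kappa> * fourier_coeff v \<kappa> = - (of_real \<nu> / 2) * fourier_coeff w \<kappa>"
    unfolding fourier_coeff_combine[OF cont(2,2)] by simp
  let ?u = "\<lambda>t. 1 * (cis (1 * t) * w t) + (- 1) * (cis (- 1 * t) * w t)"
  have contu: "continuous_on UNIV (\<lambda>t. cis (c * t) * w t)" for c by (intro continuous_intros cont)
  have contu': "continuous_on UNIV ?u" by (intro continuous_intros cont)
  have contvw: "continuous_on UNIV (\<lambda>t. - (of_real \<nu> / 2) * v t + \<i> * of_real a * w t)"
    by (intro continuous_intros cont)
  \<comment> \<open>The forcing couples each frequency to its two neighbours.\<close>
  have sin: "\<i> * of_real (sin t) = (cis t - cis (- t)) / 2" for t by (simp add: complex_eq_iff)
  have "- (of_real \<nu> / 2) * v t + \<i> * of_real (a + s * sin t) * w t =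
      1 * (- (of_real \<nu> / 2) * v t + \<i> * of_real a * w t) + of_real s / 2 * ?u t" for t
  proof -
    have eq: "\<i> * of_real (a + s * sin t) * w t = \<i> * of_real a * w t + of_real s * ((cis t - cis (- t)) / 2) * w t"
      unfolding sin[symmetric] by (simp add: algebra_simps)
    show ?thesis unfolding eq by (simp add: field_simps)
  qed
  then have "fourier_coeff (\<lambda>t. - (of_real \<nu> / 2) * v t + \<i> * of_real (a + s * sin t) * w t) \<kappa>
      = 1 * (- (of_real \<nu> / 2) * fourier_coeff v \<kappa> + \<i> * of_real a * fourier_coeff w \<kappa>) + of_real s / 2 *
        (1 * fourier_coeff w (\<kappa> - 1) + (- 1) * fourier_coeff w (\<kappa> - - 1))"
    unfolding fourier_coeff_cis[symmetric] fourier_coeff_combine[OF contu contu, symmetric]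
      fourier_coeff_combine[OF cont(1,2), symmetric] fourier_coeff_combine[OF contvw contu', symmetric]
    by (simp only:)
  moreover have "fourier_coeff (\<lambda>t. - (of_real \<nu> / 2) * v t + \<i> * of_real (a + s * sin t) * w t) \<kappa>
      = \<i> * of_real \<kappa> * fourier_coeff w \<kappa>"
    by (rule fourier_coeff_derivative[OF linear_solutionD(2)[OF lin, of _ UNIV] _ per(2)])
       (intro continuous_intros cont)
  ultimately show "\<i> * of_real \<kappa> * fourier_coeff w \<kappa> = - (of_real \<nu> / 2) * fourier_coeff v \<kappa>
      + \<i> * of_real a * fourier_coeff w \<kappa>
      + of_real s / 2 * (fourier_coeff w (\<kappa> - 1) - fourier_coeff w (\<kappa> + 1))"
    by simp
qed

text \<open>The first of the two coefficient equations expresses the coefficient of \<open>v\<close>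
  as i nu / (2 kappa) times that of \<open>w\<close>. This division is the origin of the singular
  term and of the exclusion of frequency 0.\<close>

lemma linear_solution_recurrence:
  assumes lin: "linear_solution \<nu> a s v w"
    and per: "v (2 * pi) * cis (- (\<kappa> * (2 * pi))) = v 0" "w (2 * pi) * cis (- (\<kappa> * (2 * pi))) = w 0"
    and "\<kappa> \<noteq> 0" "s \<noteq> 0"
  shows "fourier_coeff w (\<kappa> + 1) = fourier_coeff w (\<kappa> - 1)
     - 2 * \<i> * of_real ((\<kappa> - a + \<nu>\<^sup>2 / (4 * \<kappa>)) / s) * fourier_coeff w \<kappa>"
proof -
  let ?c = "fourier_coeff w" and ?k = "complex_of_real \<kappa>" and ?n = "complex_of_real \<nu>" and ?s = "complex_of_real s"
  note four = linear_solution_fourier[OF lin per]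
  have k: "?k \<noteq> 0" "?s \<noteq> 0" using assms by auto
  have "C = \<i> * (?n / (2 * ?k)) * D" if "\<i> * ?k * C = - (?n / 2) * D" for C D
  proof -
    have "C = - \<i> / ?k * (\<i> * ?k * C)" using k by (simp add: field_simps)
    also have "\<dots> = \<i> * (?n / (2 * ?k)) * D" unfolding that using k by (simp add: field_simps)
    finally show ?thesis .
  qed
  note v = this[OF four(1)]
  have Q: "- (?n / 2) * (\<i> * (?n / (2 * ?k)) * D) = - \<i> * (?n\<^sup>2 / (4 * ?k)) * D" for D
    using k by (simp add: field_simps power2_eq_square)
  have "h * cp = h * cm - \<i> * (?k - A + Q) * D"
    if "\<i> * ?k * D = - \<i> * Q * D + \<i> * A * D + h * (cm - cp)" for A D Q h cm cp
    using that by (simp add: algebra_simps)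
  note step = this[OF four(2)[unfolded v Q]]
  have "cp = cm - 2 * \<i> * (B / ?s) * D" if "?s / 2 * cp = ?s / 2 * cm - \<i> * B * D" for cp cm B D
  proof -
    have "cp = 2 / ?s * (?s / 2 * cp)" using k by simp
    also have "\<dots> = cm - 2 * \<i> * (B / ?s) * D" unfolding that using k by (simp add: field_simps)
    finally show ?thesis .
  qed
  note this[OF step]
  then show ?thesis by simp
qed

section \<open>Floquet theory for a trivial period map\<close>

locale trivial_period =
  fixes \<nu> a s :: real and r :: int
  assumes nu: "\<nu> \<noteq> 0" and s: "s \<noteq> 0"
    and period: "period_map \<nu> a s x = x + 2 * pi * real_of_int r"
begin

text \<open>Integrated over a period, the scalar equation gives nu times the integral of sin x as 2
  pi (r - a). The logarithm of v changes by -(nu/2) times the integral of cis(x), so its imaginary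
  part grows by pi (a - r) = 2 pi mu, whichever solution x is taken.\<close>

definition \<mu> :: real where "\<mu> = (a - real_of_int r) / 2"

lemma solution_periodic:
  assumes "lifted_solution \<nu> a s x"
  shows "x (t + 2 * pi) = x t + 2 * pi * real_of_int r"
  unfolding lifted_solution_period_map[OF assms] period flow_add flow_eq[OF assms] ..

lemma cis_solution_periodic: "lifted_solution \<nu> a s x \<Longrightarrow> cis (x (t + 2 * pi)) = cis (x t)"
  by (simp only: solution_periodic cis_periodic_int)

lemma linear_solution_exponent:
  assumes x: "lifted_solution \<nu> a s x"
  obtains g K where "continuous_on UNIV g" "g 0 = 0" "\<And>t. g (t + 2 * pi) = g t + K" "Im K = 2 * pi * \<mu>"
    "linear_solution \<nu> a s (\<lambda>t. exp (g t)) (\<lambda>t. cis (x t) * exp (g t))"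
proof -
  obtain G where G: "G 0 = 0" "\<And>t. (G has_vector_derivative cis (x t)) (at t)"
    and lin: "linear_solution \<nu> a s (\<lambda>t. exp (- (of_real \<nu> / 2) * G t))
       (\<lambda>t. cis (x t) * exp (- (of_real \<nu> / 2) * G t))"
    by (rule linear_solution_of_lifted_solution[OF x]) blast
  have contG: "continuous_on UNIV G"
    by (rule continuous_on_vector_derivative) (rule has_vector_derivative_at_within[OF G(2)])
  have shift: "G (t + 2 * pi) = G t + G (2 * pi)" for t
  proof -
    have "((\<lambda>t. G (t + 2 * pi)) has_vector_derivative cis (x (t + 2 * pi))) (at t)" for t
    proof -
      have "((\<lambda>t. t + 2 * pi) has_vector_derivative 1) (at t)"
        by (auto intro!: derivative_eq_intros)
      from vector_diff_chain_at[OF this G(2)[of "t + 2 * pi"]] show ?thesis by (simp add: o_def)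
    qed
    moreover note cis_solution_periodic[OF x]
    ultimately have "((\<lambda>t. G (t + 2 * pi) - G t) has_vector_derivative 0) (at t within UNIV)" for t
      using has_vector_derivative_diff[OF _ G(2)[of t], of "\<lambda>t. G (t + 2 * pi)" "cis (x t)"] by simp
    then obtain c where "\<And>t. t \<in> UNIV \<Longrightarrow> G (t + 2 * pi) - G t = c"
      using has_vector_derivative_zero_constant[of UNIV "\<lambda>t. G (t + 2 * pi) - G t"] by (metis convex_UNIV)
    from this[of t] this[of 0] G(1) show ?thesis by (simp add: algebra_simps)
  qed
  \<comment> \<open>The scalar equation itself, integrated: the sine term is the derivative of
    \<open>Im (G t)\<close>.\<close>
  have "((\<lambda>t. x t - a * t + s * cos t - \<nu> * Im (G t)) has_real_derivative 0) (at t)" for t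
  proof -
    have dIm: "((\<lambda>t. Im (G t)) has_real_derivative sin (x t)) (at t)"
      using bounded_linear.has_vector_derivative[OF bounded_linear_Im G(2)[of t]]
      by (simp add: has_real_derivative_iff_has_vector_derivative)
    have dx: "(x has_real_derivative \<nu> * sin (x t) + a + s * sin t) (at t)"
      using x by (simp add: lifted_solution_def)
    show ?thesis
      using DERIV_diff[OF DERIV_add[OF DERIV_diff[OF dx DERIV_cmult[OF DERIV_ident, of a]]
            DERIV_cmult[OF DERIV_cos, of s]] DERIV_cmult[OF dIm, of \<nu>]] by simp
  qed
  then have "x (2 * pi) - a * (2 * pi) + s * cos (2 * pi) - \<nu> * Im (G (2 * pi)) = x 0 - a * 0 + s * cos 0 - \<nu> * Im (G 0)"
    by (intro DERIV_isconst_all allI)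
  then have im: "\<nu> * Im (G (2 * pi)) = 2 * pi * (real_of_int r - a)"
    using solution_periodic[OF x, of 0] G(1) by (simp add: algebra_simps)
  show thesis
  proof (rule that)
    show "continuous_on UNIV (\<lambda>t. - (of_real \<nu> / 2) * G t)" by (intro continuous_intros contG)
    show "- (of_real \<nu> / 2) * G 0 = 0" by (simp add: G(1))
    show "- (of_real \<nu> / 2) * G (t + 2 * pi) = - (of_real \<nu> / 2) * G t + - (of_real \<nu> / 2) * G (2 * pi)" for t
      unfolding shift by (rule distrib_left)
    show "Im (- (of_real \<nu> / 2) * G (2 * pi)) = 2 * pi * \<mu>"
      using im by (simp add: \<mu>_def field_simps)
  qed (rule lin)
qed

text \<open>The Wronskian of two such solutions has constant modulus, so any two multipliers have moduli
  with product \<open>1\<close>; comparing three solutions, each modulus is \<open>1\<close>.\<close>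

lemma linear_solution_multiplier:
  assumes x: "lifted_solution \<nu> a s x"
  obtains g where "continuous_on UNIV g" "g 0 = 0"
    "\<And>t. g (t + 2 * pi) = g t + 2 * of_real pi * \<i> * of_real \<mu>"
    "linear_solution \<nu> a s (\<lambda>t. exp (g t)) (\<lambda>t. cis (x t) * exp (g t))"
proof -
  have cis_shift: "cis (y (2 * pi)) = cis (y 0)" if "lifted_solution \<nu> a s y" for y
    using cis_solution_periodic[OF that, of 0] by simp
  have pair: "Re K + Re L = 0"
    if y: "lifted_solution \<nu> a s y" and z: "lifted_solution \<nu> a s z" and ne: "cis (y 0) \<noteq> cis (z 0)"
      and g: "g 0 = 0" "g (0 + 2 * pi) = g 0 + K" "linear_solution \<nu> a s (\<lambda>t. exp (g t)) (\<lambda>t. cis (y t) * exp (g t))"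
      and h: "h 0 = 0" "h (0 + 2 * pi) = h 0 + L" "linear_solution \<nu> a s (\<lambda>t. exp (h t)) (\<lambda>t. cis (z t) * exp (h t))"
    for y z g h K L
  proof -
    have gh: "g (2 * pi) = K" "h (2 * pi) = L" using g h by simp_all
    have "exp (g (2 * pi)) * (cis (z (2 * pi)) * exp (h (2 * pi))) - cis (y (2 * pi)) * exp (g (2 * pi)) * exp (h (2 * pi))
      = (exp (g 0) * (cis (z 0) * exp (h 0)) - cis (y 0) * exp (g 0) * exp (h 0)) * cis (a * (2 * pi) - s * (cos (2 * pi) - 1))"
      by (rule linear_solution_wronskian[OF g(3) h(3)])
    then have "exp (K + L) * (cis (z 0) - cis (y 0)) = (cis (z 0) - cis (y 0)) * cis (a * (2 * pi))"
      unfolding gh g(1) h(1) cis_shift[OF y] cis_shift[OF z] exp_add by (simp add: algebra_simps)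
    then have "exp (K + L) = cis (a * (2 * pi))" using ne by (simp add: mult.commute[of "exp (K + L)"])
    then have "norm (exp (K + L)) = 1" by simp
    then show ?thesis by (simp add: norm_exp_eq_Re)
  qed
  \<comment> \<open>Two further starting angles, chosen so that the three initial points on the
    circle are distinct and the pairwise Wronskians do not vanish.\<close>
  let ?y = "flow \<nu> a s (x 0 + pi / 2)" and ?z = "flow \<nu> a s (x 0 + pi)"
  have y: "lifted_solution \<nu> a s ?y" and z: "lifted_solution \<nu> a s ?z" by (rule flow_solution)+
  have cis: "cis (?y 0) = \<i> * cis (x 0)" "cis (?z 0) = - cis (x 0)"
    by (simp_all add: complex_eq_iff sin_add cos_add)
  have "\<i> * cis (x 0) \<noteq> - cis (x 0)" "cis (x 0) \<noteq> \<i> * cis (x 0)" "cis (x 0) \<noteq> - cis (x 0)"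
  proof -
    have "\<i> + 1 \<noteq> (0::complex)" "1 - \<i> \<noteq> (0::complex)" by (simp_all add: complex_eq_iff)
    then have "(\<i> + 1) * cis (x 0) \<noteq> 0" "(1 - \<i>) * cis (x 0) \<noteq> 0" "2 * cis (x 0) \<noteq> 0"
      by simp_all
    then show "\<i> * cis (x 0) \<noteq> - cis (x 0)" "cis (x 0) \<noteq> \<i> * cis (x 0)" "cis (x 0) \<noteq> - cis (x 0)"
      by (auto simp: algebra_simps eq_neg_iff_add_eq_0)
  qed
  then have ne: "cis (x 0) \<noteq> cis (?y 0)" "cis (x 0) \<noteq> cis (?z 0)" "cis (?y 0) \<noteq> cis (?z 0)"
    unfolding cis by auto
  obtain g K where g: "continuous_on UNIV g" "g 0 = 0" "\<And>t. g (t + 2 * pi) = g t + K" "Im K = 2 * pi * \<mu>"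
    "linear_solution \<nu> a s (\<lambda>t. exp (g t)) (\<lambda>t. cis (x t) * exp (g t))"
    by (rule linear_solution_exponent[OF x]) blast
  obtain h L where h: "h 0 = 0" "\<And>t. h (t + 2 * pi) = h t + L"
    "linear_solution \<nu> a s (\<lambda>t. exp (h t)) (\<lambda>t. cis (?y t) * exp (h t))"
    by (rule linear_solution_exponent[OF y]) blast
  obtain k M where k: "k 0 = 0" "\<And>t. k (t + 2 * pi) = k t + M"
    "linear_solution \<nu> a s (\<lambda>t. exp (k t)) (\<lambda>t. cis (?z t) * exp (k t))"
    by (rule linear_solution_exponent[OF z]) blast
  have "Re K = 0"
    using pair[OF x y ne(1) g(2) g(3) g(5) h] pair[OF x z ne(2) g(2) g(3) g(5) k] pair[OF y z ne(3) h k]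
    by linarith
  then have "K = 2 * of_real pi * \<i> * of_real \<mu>" using g(4) by (simp add: complex_eq_iff)
  with g show thesis by (intro that[of g]) auto
qed

text \<open>As all multipliers coincide, linear combinations keep the multiplier. The sums of the
  basis solutions recover exp(g) and cis(x) exp(g) for the solution starting at 0, whose logarithms
  are explicit; hence the winding numbers are stated for sums.\<close>

lemma floquet_basis:
  obtains A1 A2 B1 B2 where "linear_solution \<nu> a s A1 A2" "linear_solution \<nu> a s B1 B2"
    "A1 0 = 1" "A2 0 = 0" "B1 0 = 0" "B2 0 = 1"
    "\<And>t. A1 (t + 2 * pi) = cis (2 * pi * \<mu>) * A1 t" "\<And>t. A2 (t + 2 * pi) = cis (2 * pi * \<mu>) * A2 t"
    "\<And>t. B1 (t + 2 * pi) = cis (2 * pi * \<mu>) * B1 t" "\<And>t. B2 (t + 2 * pi) = cis (2 * pi * \<mu>) * B2 t"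
    "winds (\<lambda>t. A1 t + B1 t) \<mu>" "winds (\<lambda>t. A2 t + B2 t) (\<mu> + real_of_int r)"
proof -
  let ?x = "flow \<nu> a s 0" and ?y = "flow \<nu> a s pi"
  have x: "lifted_solution \<nu> a s ?x" and y: "lifted_solution \<nu> a s ?y" by (rule flow_solution)+
  have exp_mu: "exp (w + 2 * of_real pi * \<i> * of_real \<mu>) = cis (2 * pi * \<mu>) * exp w" for w
    by (simp add: exp_add cis_conv_exp mult_ac)
  obtain g where g: "continuous_on UNIV g" "g 0 = 0"
    "\<And>t. g (t + 2 * pi) = g t + 2 * of_real pi * \<i> * of_real \<mu>"
    "linear_solution \<nu> a s (\<lambda>t. exp (g t)) (\<lambda>t. cis (?x t) * exp (g t))"
    by (rule linear_solution_multiplier[OF x]) blast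
  obtain h where h: "continuous_on UNIV h" "h 0 = 0"
    "\<And>t. h (t + 2 * pi) = h t + 2 * of_real pi * \<i> * of_real \<mu>"
    "linear_solution \<nu> a s (\<lambda>t. exp (h t)) (\<lambda>t. cis (?y t) * exp (h t))"
    by (rule linear_solution_multiplier[OF y]) blast
  let ?A1 = "\<lambda>t. 1/2 * exp (g t) + 1/2 * exp (h t)" and ?B1 = "\<lambda>t. 1/2 * exp (g t) + (- 1/2) * exp (h t)"
  let ?A2 = "\<lambda>t. 1/2 * (cis (?x t) * exp (g t)) + 1/2 * (cis (?y t) * exp (h t))"
  let ?B2 = "\<lambda>t. 1/2 * (cis (?x t) * exp (g t)) + (- 1/2) * (cis (?y t) * exp (h t))"
  show thesis
  proof (rule that)
    show "linear_solution \<nu> a s ?A1 ?A2" "linear_solution \<nu> a s ?B1 ?B2"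
      by (rule linear_solution_combine[OF g(4) h(4)])+
    show "winds (\<lambda>t. ?A1 t + ?B1 t) \<mu>"
      unfolding winds_def by (rule exI[of _ g]) (use g in simp)
    have contx: "continuous_on UNIV ?x"
      by (rule DERIV_continuous_on)
         (use x in \<open>auto simp: lifted_solution_def intro: has_field_derivative_at_within\<close>)
    show "winds (\<lambda>t. ?A2 t + ?B2 t) (\<mu> + real_of_int r)"
      unfolding winds_def
    proof (intro exI[of _ "\<lambda>t. \<i> * of_real (?x t) + g t"] conjI allI)
      show "continuous_on UNIV (\<lambda>t. \<i> * of_real (?x t) + g t)"
        by (intro continuous_intros g contx)
      show "?A2 t + ?B2 t = exp (\<i> * of_real (?x t) + g t)" for t
        by (simp add: exp_add cis_conv_exp)
      show "\<i> * of_real (?x (t + 2 * pi)) + g (t + 2 * pi) =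
          \<i> * of_real (?x t) + g t + 2 * of_real pi * \<i> * of_real (\<mu> + real_of_int r)" for t
        unfolding g(3) solution_periodic[OF x] by (simp add: algebra_simps)
    qed
    have eg: "exp (g (t + 2 * pi)) = cis (2 * pi * \<mu>) * exp (g t)" for t unfolding g(3) by (rule exp_mu)
    have eh: "exp (h (t + 2 * pi)) = cis (2 * pi * \<mu>) * exp (h t)" for t unfolding h(3) by (rule exp_mu)
    show "?A1 (t + 2 * pi) = cis (2 * pi * \<mu>) * ?A1 t" "?B1 (t + 2 * pi) = cis (2 * pi * \<mu>) * ?B1 t"
      "?A2 (t + 2 * pi) = cis (2 * pi * \<mu>) * ?A2 t" "?B2 (t + 2 * pi) = cis (2 * pi * \<mu>) * ?B2 t" for t
      unfolding eg eh cis_solution_periodic[OF x] cis_solution_periodic[OF y] by (simp_all add: algebra_simps)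
  qed (simp_all add: g(2) h(2))
qed

end

context trivial_period
begin

lemma floquet_normalized:
  assumes "f (0 + 2 * pi) = cis (2 * pi * \<mu>) * f 0"
  shows "f (2 * pi) * cis (- ((\<mu> + real_of_int n) * (2 * pi))) = f 0"
proof -
  have "cis (2 * pi * \<mu>) * cis (- ((\<mu> + real_of_int n) * (2 * pi))) = cis (0 + 2 * pi * real_of_int (- n))"
    by (simp add: cis_mult algebra_simps)
  also have "\<dots> = 1" unfolding cis_periodic_int by simp
  finally have one: "cis (2 * pi * \<mu>) * cis (- ((\<mu> + real_of_int n) * (2 * pi))) = 1" .
  have "f (2 * pi) * cis (- ((\<mu> + real_of_int n) * (2 * pi))) =
      (cis (2 * pi * \<mu>) * cis (- ((\<mu> + real_of_int n) * (2 * pi)))) * f 0"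
    using assms by simp
  then show ?thesis unfolding one by simp
qed

definition floquet :: "(real \<Rightarrow> complex) \<Rightarrow> (real \<Rightarrow> complex) \<Rightarrow> bool" where
  "floquet v w \<longleftrightarrow> linear_solution \<nu> a s v w \<and>
     (\<forall>t. v (t + 2 * pi) = cis (2 * pi * \<mu>) * v t \<and> w (t + 2 * pi) = cis (2 * pi * \<mu>) * w t)"

lemma floquet_combine:
  "floquet v w \<Longrightarrow> floquet v' w' \<Longrightarrow> floquet (\<lambda>t. c * v t + d * v' t) (\<lambda>t. c * w t + d * w' t)"
  unfolding floquet_def by (auto intro: linear_solution_combine simp: algebra_simps)

lemma floquet_recurrence:
  assumes "floquet v w" and nz: "\<mu> + real_of_int n \<noteq> 0"
  shows "fourier_coeff w (\<mu> + real_of_int (n + 1)) = fourier_coeff w (\<mu> + real_of_int (n - 1))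
    - 2 * \<i> * of_real ((\<mu> + real_of_int n - a + \<nu>\<^sup>2 / (4 * (\<mu> + real_of_int n))) / s)
      * fourier_coeff w (\<mu> + real_of_int n)"
proof -
  have lin: "linear_solution \<nu> a s v w"
    and v: "v (0 + 2 * pi) = cis (2 * pi * \<mu>) * v 0" and w: "w (0 + 2 * pi) = cis (2 * pi * \<mu>) * w 0"
    using assms unfolding floquet_def by blast+
  have shift: "\<mu> + real_of_int (n + 1) = \<mu> + real_of_int n + 1"
    "\<mu> + real_of_int (n - 1) = \<mu> + real_of_int n - 1"
    by simp_all
  show ?thesis
    using linear_solution_recurrence[OF lin floquet_normalized[OF v] floquet_normalized[OF w] nz s]
    unfolding shift .
qed

text \<open>Multiplication by cis(-mu t) makes \<open>w\<close> periodic and moves its frequencies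
  to the integers. Once \<open>w\<close> vanishes, the second equation leaves (nu/2) v = 0.\<close>

lemma floquet_eq_zero:
  assumes fl: "floquet v w" and zero: "\<And>n::int. fourier_coeff w (\<mu> + real_of_int n) = 0"
  shows "v t = 0" "w t = 0"
proof -
  have lin: "linear_solution \<nu> a s v w"
    and per: "\<And>t. w (t + 2 * pi) = cis (2 * pi * \<mu>) * w t"
    using fl unfolding floquet_def by blast+
  let ?f = "\<lambda>t. cis (- \<mu> * t) * w t"
  have "?f t = 0" for t
  proof (rule fourier_coeff_zero_imp_zero[of ?f])
    show "continuous_on UNIV ?f" by (intro continuous_intros linear_solution_continuous[OF lin])
    show "?f (t + 2 * pi) = ?f t" for t
    proof -
      have "cis (- \<mu> * (t + 2 * pi)) * cis (2 * pi * \<mu>) = cis (- \<mu> * t)"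
        by (simp add: cis_mult algebra_simps)
      then show ?thesis unfolding per by (metis mult.assoc)
    qed
    show "fourier_coeff ?f (of_int n) = 0" for n
      unfolding fourier_coeff_cis using zero[of n] by (simp add: add.commute)
  qed
  then have w: "w t = 0" for t by simp
  have "(w has_vector_derivative - (of_real \<nu> / 2) * v t) (at t)" for t
    using linear_solutionD(2)[OF lin, of t UNIV] by (simp add: w)
  moreover have "w = (\<lambda>t. 0)" using w by blast
  ultimately have "((\<lambda>t. 0) has_vector_derivative - (of_real \<nu> / 2) * v t) (at t)" for t by simp
  from vector_derivative_unique_at[OF this has_vector_derivative_const]
  show "v t = 0" using nu by simp
  show "w t = 0" by (rule w)
qed

text \<open>If \<open>\<mu>\<close> were not an integer, the recurrence would have no singular index. Its Casoratian has
  constant modulus, and tends to \<open>0\<close> for two Floquet solutions, so these would be proportional.\<close>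

lemma exponent_integer: "\<mu> \<in> \<int>"
proof (rule ccontr)
  assume nonint: "\<mu> \<notin> \<int>"
  have nz: "\<mu> + real_of_int n \<noteq> 0" for n
  proof
    assume "\<mu> + real_of_int n = 0"
    then have "\<mu> = real_of_int (- n)" by simp
    then show False using nonint by simp
  qed
  obtain A1 A2 B1 B2 where basis: "linear_solution \<nu> a s A1 A2" "linear_solution \<nu> a s B1 B2"
    "A1 0 = 1" "A2 0 = 0" "B1 0 = 0" "B2 0 = 1"
    "\<And>t. A1 (t + 2 * pi) = cis (2 * pi * \<mu>) * A1 t" "\<And>t. A2 (t + 2 * pi) = cis (2 * pi * \<mu>) * A2 t"
    "\<And>t. B1 (t + 2 * pi) = cis (2 * pi * \<mu>) * B1 t" "\<And>t. B2 (t + 2 * pi) = cis (2 * pi * \<mu>) * B2 t"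
    by (rule floquet_basis) blast
  have A: "floquet A1 A2" and B: "floquet B1 B2" using basis unfolding floquet_def by blast+
  define c where "c n = fourier_coeff A2 (\<mu> + real_of_int n)" for n
  define d where "d n = fourier_coeff B2 (\<mu> + real_of_int n)" for n
  define k where "k n = 2 * \<i> * complex_of_real ((\<mu> + real_of_int n - a + \<nu>\<^sup>2 / (4 * (\<mu> + real_of_int n))) / s)" for n
  have rec: "fourier_coeff w (\<mu> + real_of_int (n + 1)) =
    fourier_coeff w (\<mu> + real_of_int (n - 1)) - k n * fourier_coeff w (\<mu> + real_of_int n)"
    if "floquet v w" for v w n
    unfolding k_def by (rule floquet_recurrence[OF that nz])
  \<comment> \<open>The Casoratian, the discrete analogue of the Wronskian; each step of the
    recurrence only changes its sign.\<close>
  define W where "W n = c n * d (n + 1) - c (n + 1) * d n" for n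
  have step: "W n = - W (n - 1)" for n
  proof -
    have c: "c (n + 1) = c (n - 1) - k n * c n" and d: "d (n + 1) = d (n - 1) - k n * d n"
      using rec[OF A, of n] rec[OF B, of n] unfolding c_def d_def .
    have "W (n - 1) = c (n - 1) * d n - c n * d (n - 1)" by (simp add: W_def)
    then show ?thesis unfolding W_def[of n] c d by (simp add: algebra_simps)
  qed
  have const: "norm (W (n + int m)) = norm (W n)" for n m
  proof (induction m)
    case (Suc m)
    then show ?case using step[of "n + int (Suc m)"] by simp
  qed simp
  have lim: "(\<lambda>m. fourier_coeff w (\<mu> + real_of_int (n + int m))) \<longlonglongrightarrow> 0"
    if fl: "floquet v w" for v w n
  proof -
    have lin: "linear_solution \<nu> a s v w"
      and per: "w (0 + 2 * pi) = cis (2 * pi * \<mu>) * w 0"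
      using fl unfolding floquet_def by blast+
    have cont: "continuous_on UNIV (\<lambda>t. - (of_real \<nu> / 2) * v t + \<i> * of_real (a + s * sin t) * w t)"
      by (intro continuous_intros linear_solution_continuous[OF lin])
    have "(\<lambda>m. fourier_coeff w ((\<mu> + real_of_int n) + real m)) \<longlonglongrightarrow> 0"
    proof (rule fourier_coeff_tendsto_zero[OF linear_solutionD(2)[OF lin] cont])
      fix m
      show "w (2 * pi) * cis (- ((\<mu> + real_of_int n + real m) * (2 * pi))) = w 0"
        using floquet_normalized[of w "n + int m", OF per] by (simp add: add.assoc)
    qed
    then show ?thesis by (simp add: add.assoc)
  qed
  have Wzero: "W n = 0" for n
  proof -
    have "(\<lambda>m. c (n + int m) * d ((n + 1) + int m) - c ((n + 1) + int m) * d (n + int m)) \<longlonglongrightarrow> 0 * 0 - 0 * 0"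
      unfolding c_def d_def by (intro tendsto_diff tendsto_mult lim[OF A] lim[OF B])
    moreover have "c (n + int m) * d ((n + 1) + int m) - c ((n + 1) + int m) * d (n + int m) = W (n + int m)" for m
      by (simp add: W_def algebra_simps)
    ultimately have "(\<lambda>m. norm (W (n + int m))) \<longlonglongrightarrow> norm (0 :: complex)"
      by (intro tendsto_norm) simp
    then have "norm (W n) = 0" unfolding const using LIMSEQ_unique[OF tendsto_const] by fastforce
    then show ?thesis by simp
  qed
  \<comment> \<open>Vanishing of \<open>W 0\<close> makes the vectors of coefficients at 0 and 1
    linearly dependent.\<close>
  have "\<exists>\<alpha> \<beta>. (\<alpha> \<noteq> 0 \<or> \<beta> \<noteq> 0) \<and> \<alpha> * c 0 + \<beta> * d 0 = 0 \<and> \<alpha> * c 1 + \<beta> * d 1 = 0"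
  proof (cases "c 0 = 0 \<and> d 0 = 0")
    case True
    show ?thesis
    proof (cases "c 1 = 0 \<and> d 1 = 0")
      case True
      then show ?thesis using \<open>c 0 = 0 \<and> d 0 = 0\<close> by (intro exI[of _ 1] exI[of _ 0]) simp
    next
      case False
      then show ?thesis using \<open>c 0 = 0 \<and> d 0 = 0\<close>
        by (intro exI[of _ "d 1"] exI[of _ "- c 1"]) auto
    qed
  next
    case False
    then show ?thesis using Wzero[of 0]
      by (intro exI[of _ "d 0"] exI[of _ "- c 0"]) (auto simp: W_def algebra_simps)
  qed
  then obtain \<alpha> \<beta> where ab: "\<alpha> \<noteq> 0 \<or> \<beta> \<noteq> 0" "\<alpha> * c 0 + \<beta> * d 0 = 0" "\<alpha> * c 1 + \<beta> * d 1 = 0"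
    by blast
  let ?v = "\<lambda>t. \<alpha> * A1 t + \<beta> * B1 t" and ?w = "\<lambda>t. \<alpha> * A2 t + \<beta> * B2 t"
  have fl: "floquet ?v ?w" by (rule floquet_combine[OF A B])
  define e where "e n = fourier_coeff ?w (\<mu> + real_of_int n)" for n
  have e: "e n = \<alpha> * c n + \<beta> * d n" for n
    unfolding e_def c_def d_def
    by (rule fourier_coeff_combine) (rule linear_solution_continuous[OF basis(1)] linear_solution_continuous[OF basis(2)])+
  have erec: "e (n + 1) = e (n - 1) - k n * e n" for n
    using rec[OF fl, of n] unfolding e_def .
  \<comment> \<open>Two consecutive zeros spread in both directions, since no index is
    singular.\<close>
  have "e n = 0 \<and> e (n + 1) = 0" for n
  proof (induction n rule: int_induct[of _ 0])
    case base
    then show ?case using ab by (simp add: e)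
  next
    case (step1 i)
    then show ?case using erec[of "i + 1"] by simp
  next
    case (step2 i)
    then show ?case using erec[of i] by simp
  qed
  then have "fourier_coeff ?w (\<mu> + real_of_int n) = 0" for n unfolding e_def by blast
  from floquet_eq_zero[OF fl this, of 0] show False using ab(1) basis by simp
qed

text \<open>The exponent being an integer, the recurrence is singular at frequency \<open>0\<close>, which decouples
  positive from negative frequencies: some nonzero solution has no negative frequencies. The
  winding numbers of its components are therefore nonnegative.\<close>

lemma winding_alternative: "\<mu> \<ge> 0 \<or> \<mu> + real_of_int r \<ge> 1"
proof -
  obtain A1 A2 B1 B2 where basis: "linear_solution \<nu> a s A1 A2" "linear_solution \<nu> a s B1 B2"
    "A1 0 = 1" "A2 0 = 0" "B1 0 = 0" "B2 0 = 1"
    "\<And>t. A1 (t + 2 * pi) = cis (2 * pi * \<mu>) * A1 t" "\<And>t. A2 (t + 2 * pi) = cis (2 * pi * \<mu>) * A2 t"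
    "\<And>t. B1 (t + 2 * pi) = cis (2 * pi * \<mu>) * B1 t" "\<And>t. B2 (t + 2 * pi) = cis (2 * pi * \<mu>) * B2 t"
    and winds: "winds (\<lambda>t. A1 t + B1 t) \<mu>" "winds (\<lambda>t. A2 t + B2 t) (\<mu> + real_of_int r)"
    by (rule floquet_basis) blast
  have A: "floquet A1 A2" and B: "floquet B1 B2" using basis unfolding floquet_def by blast+
  note cont = linear_solution_continuous[OF basis(1), of UNIV] linear_solution_continuous[OF basis(2), of UNIV]
  obtain m where m: "\<mu> = real_of_int m" using exponent_integer by (elim Ints_cases)
  have "cis (2 * pi * \<mu>) = 1"
    using cis_periodic_int[of 0 m] by (simp add: m)
  then have per: "A1 (t + 2 * pi) = A1 t" "A2 (t + 2 * pi) = A2 t" "B1 (t + 2 * pi) = B1 t" "B2 (t + 2 * pi) = B2 t" for t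
    using basis by simp_all
  \<comment> \<open>The matrix of basis solutions lies in U(1,1). Orthogonality of its columns gives
    |A2| = |B1|, and the normalisations make the diagonal entries strictly larger.\<close>
  have norms: "norm (B1 t) < norm (A1 t)" "norm (A2 t) < norm (B2 t)" for t
  proof -
    have a: "(norm (A2 t))\<^sup>2 - (norm (A1 t))\<^sup>2 = - 1" and b: "(norm (B2 t))\<^sup>2 - (norm (B1 t))\<^sup>2 = 1"
      using linear_solution_norm[OF basis(1), of t] linear_solution_norm[OF basis(2), of t] basis by simp_all
    have "cnj (A2 t) * B2 t = cnj (A1 t) * B1 t"
      using linear_solution_hermitian[OF basis(1,2), of t] basis by simp
    then have "norm (cnj (A2 t) * B2 t) = norm (cnj (A1 t) * B1 t)" by (rule arg_cong)
    then have "(norm (A2 t) * norm (B2 t))\<^sup>2 = (norm (A1 t) * norm (B1 t))\<^sup>2" by (simp add: norm_mult)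
    then have "(norm (A2 t))\<^sup>2 * (1 + (norm (B1 t))\<^sup>2) = (1 + (norm (A2 t))\<^sup>2) * (norm (B1 t))\<^sup>2"
      using a b by (simp add: power_mult_distrib algebra_simps)
    then have eq: "(norm (A2 t))\<^sup>2 = (norm (B1 t))\<^sup>2" by (simp add: algebra_simps)
    have sq: "(norm (B1 t))\<^sup>2 < (norm (A1 t))\<^sup>2" "(norm (A2 t))\<^sup>2 < (norm (B2 t))\<^sup>2"
      using a b eq by linarith+
    show "norm (B1 t) < norm (A1 t)" "norm (A2 t) < norm (B2 t)"
      by (rule power2_less_imp_less[OF sq(1)] power2_less_imp_less[OF sq(2)], simp)+
  qed
  define c where "c = fourier_coeff A2 (- 1)"
  define d where "d = fourier_coeff B2 (- 1)"
  \<comment> \<open>One linear condition on a two-dimensional space: some nonzero solution has no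
    coefficient at frequency -1 in \<open>w\<close>.\<close>
  have "\<exists>\<alpha> \<beta>. (\<alpha> \<noteq> 0 \<or> \<beta> \<noteq> 0) \<and> \<alpha> * c + \<beta> * d = 0"
  proof (cases "c = 0")
    case True
    then show ?thesis by (intro exI[of _ 1] exI[of _ 0]) simp
  next
    case False
    then show ?thesis by (intro exI[of _ d] exI[of _ "- c"]) simp
  qed
  then obtain \<alpha> \<beta> where ab: "\<alpha> \<noteq> 0 \<or> \<beta> \<noteq> 0" "\<alpha> * c + \<beta> * d = 0" by blast
  let ?v = "\<lambda>t. \<alpha> * A1 t + \<beta> * B1 t" and ?w = "\<lambda>t. \<alpha> * A2 t + \<beta> * B2 t"
  have fl: "floquet ?v ?w" by (rule floquet_combine[OF A B])
  then have lin: "linear_solution \<nu> a s ?v ?w" unfolding floquet_def by blast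
  have normalized: "?v (2 * pi) * cis (- (real_of_int n * (2 * pi))) = ?v 0"
    "?w (2 * pi) * cis (- (real_of_int n * (2 * pi))) = ?w 0" for n
  proof -
    have "?v (0 + 2 * pi) = cis (2 * pi * \<mu>) * ?v 0" "?w (0 + 2 * pi) = cis (2 * pi * \<mu>) * ?w 0"
      using fl unfolding floquet_def by blast+
    from floquet_normalized[of ?v "n - m", OF this(1)] floquet_normalized[of ?w "n - m", OF this(2)]
    show "?v (2 * pi) * cis (- (real_of_int n * (2 * pi))) = ?v 0"
      "?w (2 * pi) * cis (- (real_of_int n * (2 * pi))) = ?w 0" by (simp_all add: m)
  qed
  \<comment> \<open>At frequency 0 the left-hand side of the first coefficient equation is 0, which
    forces the coefficient of \<open>w\<close> to vanish for every solution.\<close>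
  have w0: "fourier_coeff ?w 0 = 0"
    using linear_solution_fourier(1)[OF lin, of 0] normalized[of 0] nu by simp
  have w1: "fourier_coeff ?w (- 1) = 0"
    unfolding fourier_coeff_combine[OF cont(2) cont(4)] using ab(2) by (simp add: c_def d_def)
  \<comment> \<open>From the zeros at 0 and -1 the recurrence descends through strictly negative
    frequencies only, where it is regular.\<close>
  have "fourier_coeff ?w (- real n) = 0 \<and> fourier_coeff ?w (- real (Suc n)) = 0" for n
  proof (induction n)
    case 0
    then show ?case using w0 w1 by simp
  next
    case (Suc n)
    have "fourier_coeff ?w (- real (Suc n) + 1) = fourier_coeff ?w (- real (Suc n) - 1)
      - 2 * \<i> * of_real ((- real (Suc n) - a + \<nu>\<^sup>2 / (4 * - real (Suc n))) / s) * fourier_coeff ?w (- real (Suc n))"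
      by (rule linear_solution_recurrence[OF lin]) (use normalized[of "- int (Suc n)"] s in simp_all)
    moreover have "- real (Suc n) + 1 = - real n" "- real (Suc n) - 1 = - real (Suc (Suc n))" by simp_all
    ultimately show ?case using Suc by simp
  qed
  then have wneg: "fourier_coeff ?w (real_of_int n) = 0" if "n \<le> 0" for n :: int
    using that by (metis nonpos_int_cases of_int_minus of_int_of_nat_eq)
  have vneg: "fourier_coeff ?v (real_of_int n) = 0" if "n < 0" for n :: int
    using linear_solution_fourier(1)[OF lin normalized, of n] wneg[of n] that by simp
  show ?thesis
  \<comment> \<open>The larger coefficient decides which component has a dominant diagonal term, and
    therefore no zeros and a known winding number.\<close>
  proof (cases "norm \<beta> \<le> norm \<alpha>")
    case True
    then have "\<alpha> \<noteq> 0" using ab(1) by auto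
    have "winds A1 \<mu>" by (rule winds_cancel_dominated[OF winds(1) cont(1,3) per(1,3) norms(1)])
    from winds_mult[OF winds_const[OF \<open>\<alpha> \<noteq> 0\<close>] this] have wA: "winds (\<lambda>t. \<alpha> * A1 t) \<mu>" by simp
    have "winds ?v \<mu>"
    proof (rule winds_dominated[OF wA])
      show "norm (\<beta> * B1 t) < norm (\<alpha> * A1 t)" for t
        unfolding norm_mult using True \<open>\<alpha> \<noteq> 0\<close> norms(1)[of t]
        by (meson mult_le_less_imp_less norm_ge_zero zero_less_norm_iff mult_right_mono mult_strict_left_mono order_le_less_trans)
    qed (auto intro!: continuous_intros cont simp: per)
    moreover have "continuous_on UNIV ?v" by (intro continuous_intros cont)
    ultimately have "\<mu> \<ge> 0" by (intro winding_nonneg[of ?v \<mu>]) (auto simp: per vneg)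
    then show ?thesis by blast
  next
    case False
    then have "\<beta> \<noteq> 0" by auto
    have "winds (\<lambda>t. B2 t + A2 t) (\<mu> + real_of_int r)" using winds(2) by (simp add: add.commute)
    then have "winds B2 (\<mu> + real_of_int r)"
      by (rule winds_cancel_dominated[OF _ cont(4,2) per(4,2) norms(2)])
    from winds_mult[OF winds_const[OF \<open>\<beta> \<noteq> 0\<close>] this]
    have wB: "winds (\<lambda>t. \<beta> * B2 t) (\<mu> + real_of_int r)" by simp
    have "winds (\<lambda>t. \<beta> * B2 t + \<alpha> * A2 t) (\<mu> + real_of_int r)"
    proof (rule winds_dominated[OF wB])
      show "norm (\<alpha> * A2 t) < norm (\<beta> * B2 t)" for t
        unfolding norm_mult using False \<open>\<beta> \<noteq> 0\<close> norms(2)[of t]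
        by (meson mult_right_mono mult_strict_left_mono norm_ge_zero zero_less_norm_iff order_le_less_trans linear)
    qed (auto intro!: continuous_intros cont simp: per)
    then have w: "winds ?w (\<mu> + real_of_int r)" by (simp add: add.commute)
    \<comment> \<open>Since \<open>?w\<close> also lacks frequency 0, it can be divided by cis(t)
      without acquiring negative frequencies. This yields the bound 1 instead of 0.\<close>
    let ?u = "\<lambda>t. cis (- 1 * t) * ?w t"
    have "winds (\<lambda>t. cis (- 1 * t)) (- 1)"
      unfolding winds_def by (rule exI[of _ "\<lambda>t. - \<i> * of_real t"])
        (auto intro!: continuous_intros simp: cis_conv_exp algebra_simps)
    from winds_mult[OF this w] have "winds ?u (- 1 + (\<mu> + real_of_int r))" .
    moreover have "continuous_on UNIV ?u" by (intro continuous_intros cont)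
    moreover have "?u (t + 2 * pi) = ?u t" for t
    proof -
      have "cis (- 1 * (t + 2 * pi)) = cis (- 1 * t)" by (simp add: complex_eq_iff cos_diff sin_diff)
      then show ?thesis unfolding per by simp
    qed
    moreover have "fourier_coeff ?u (of_int n) = 0" if "n < 0" for n
      unfolding fourier_coeff_cis using wneg[of "n + 1"] that by simp
    ultimately have "- 1 + (\<mu> + real_of_int r) \<ge> 0" by (intro winding_nonneg[of ?u])
    then show ?thesis by simp
  qed
qed

lemma reflect: "trivial_period \<nu> (- a) s (- r)"
proof
  show "\<nu> \<noteq> 0" "s \<noteq> 0" by (rule nu s)+
  fix x
  let ?y = "flow \<nu> (- a) s x"
  have "lifted_solution \<nu> a s (\<lambda>t. - ?y (t + pi))"
    using lifted_solution_reflect[OF flow_solution, of \<nu> "- a" s x] by simp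
  from solution_periodic[OF this, of "- pi"]
  show "period_map \<nu> (- a) s x = x + 2 * pi * real_of_int (- r)"
    by (simp add: period_map_def)
qed

text \<open>The reflected solution obeys the equation with the parameter -a, which is at least
  \<open>a\<close>. Started at the same point, it advances by -2 pi r over a period and the original
  by 2 pi r, so comparison gives r \<le> -r.\<close>

lemma nonpos: "a \<le> 0 \<Longrightarrow> r \<le> 0"
proof -
  assume "a \<le> 0"
  let ?y = "flow \<nu> a s 0"
  let ?z = "\<lambda>t. - ?y (t + pi)"
  have z: "lifted_solution \<nu> (- a) s ?z" by (rule lifted_solution_reflect[OF flow_solution])
  have "flow \<nu> a s (?z 0) (2 * pi) \<le> ?z (2 * pi)"
    by (rule lifted_solution_mono[OF flow_solution z]) (use \<open>a \<le> 0\<close> in auto)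
  moreover have "flow \<nu> a s (?z 0) (2 * pi) = ?z 0 + 2 * pi * real_of_int r"
    using period[of "?z 0"] by (simp add: period_map_def)
  moreover have "?z (2 * pi) = ?z 0 - 2 * pi * real_of_int r"
    using solution_periodic[OF flow_solution[of \<nu> a s 0], of pi] by (simp add: add.commute)
  ultimately have "2 * pi * real_of_int r \<le> 0" by linarith
  then show "r \<le> 0" using pi_gt_zero by (auto simp: mult_le_0_iff)
qed

end

section \<open>From trivial period maps to the four assertions\<close>

lemma trivial_period_abscissa:
  assumes "trivial_period \<nu> a s r"
  shows "a \<in> \<int>" "(a - real_of_int r) / 2 \<in> \<int>" "\<bar>a\<bar> \<le> \<bar>real_of_int r\<bar>" "sgn a = sgn (real_of_int r)"
proof -
  interpret P: trivial_period \<nu> a s r by (rule assms)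
  interpret Q: trivial_period \<nu> "- a" s "- r" by (rule P.reflect)
  show even: "(a - real_of_int r) / 2 \<in> \<int>" using P.exponent_integer unfolding P.\<mu>_def .
  then obtain m where "(a - real_of_int r) / 2 = real_of_int m" by (elim Ints_cases)
  then have "a = real_of_int (2 * m + r)" by simp
  then show "a \<in> \<int>" by (metis Ints_of_int)
  show abs: "\<bar>a\<bar> \<le> \<bar>real_of_int r\<bar>"
  proof -
    \<comment> \<open>Both left alternatives give a = r, the mixed cases place a between -|r| and
      |r|, and both right ones contradict each other.\<close>
    have "real_of_int r \<le> a \<or> 2 \<le> a + real_of_int r" "a \<le> real_of_int r \<or> 2 \<le> - a - real_of_int r"
      using P.winding_alternative Q.winding_alternative unfolding P.\<mu>_def Q.\<mu>_def
      by (simp_all add: field_simps)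
    then show ?thesis by (elim disjE) linarith+
  qed
  \<comment> \<open>For a = 0 both implications apply and give r = 0; conversely r = 0 gives a = 0
    by the bound on |a|. The strict signs follow.\<close>
  have "a \<le> 0 \<Longrightarrow> real_of_int r \<le> 0" "0 \<le> a \<Longrightarrow> 0 \<le> real_of_int r"
    using P.nonpos Q.nonpos by auto
  with abs show "sgn a = sgn (real_of_int r)" by (auto simp: sgn_real_def)
qed

lemma adjacency_trivial_period:
  assumes "is_adjacency \<nu> r (a, s)" "\<nu> \<noteq> 0"
  obtains k where "r = real_of_int k" "trivial_period \<nu> a s k"
proof -
  have tongue: "is_arnold_tongue \<nu> r" and s: "s \<noteq> 0" using assms(1) by (auto simp: is_adjacency_def)
  obtain k where k: "r = real_of_int k" by (rule arnold_tongue_integer[OF tongue])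
  have "trivial_period \<nu> a s k"
    using assms s adjacency_period_map[of \<nu> k a s] unfolding k trivial_period_def by blast
  with k show ?thesis by (rule that)
qed

lemma adjacency_abscissa:
  assumes "is_adjacency \<nu> (real_of_int r) (a, s)" "\<nu> \<noteq> 0"
  shows "a \<in> \<int>" "(a - real_of_int r) / 2 \<in> \<int>" "\<bar>a\<bar> \<le> \<bar>real_of_int r\<bar>" "sgn a = sgn (real_of_int r)"
proof -
  have "trivial_period \<nu> a s r" using adjacency_trivial_period[OF assms] by (metis of_int_eq_iff)
  from trivial_period_abscissa[OF this]
  show "a \<in> \<int>" "(a - real_of_int r) / 2 \<in> \<int>" "\<bar>a\<bar> \<le> \<bar>real_of_int r\<bar>" "sgn a = sgn (real_of_int r)" .
qed

theorem theorem1p2: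
  fixes \<nu> :: real
  assumes "\<nu> \<noteq> 0"
  shows
    "(\<bar>\<nu>\<bar> \<le> 1 \<longrightarrow>
       (\<forall>r::int. \<forall>a s. is_adjacency \<nu> (real_of_int r) (a, s) \<longrightarrow> a = real_of_int r)) \<and>
     (\<forall>r::real. \<forall>a s. is_adjacency \<nu> r (a, s) \<longrightarrow> a \<in> \<int>) \<and>
     (\<forall>r::int. \<forall>a s. is_adjacency \<nu> (real_of_int r) (a, s) \<longrightarrow>
        sgn a = sgn (real_of_int r) \<and> \<bar>a\<bar> \<le> \<bar>real_of_int r\<bar>) \<and>
     {(a, s). is_adjacency \<nu> 0 (a, s)} =
       {(a, s). (\<exists>r::real. is_adjacency \<nu> r (a, s)) \<and> a = 0}"
proof (intro conjI impI allI)
  fix r :: int and a s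
  assume "\<bar>\<nu>\<bar> \<le> 1" and adj: "is_adjacency \<nu> (real_of_int r) (a, s)"
  from adjacency_abscissa(2)[OF adj assms] obtain m where m: "(a - real_of_int r) / 2 = real_of_int m"
    by (elim Ints_cases)
  have "rotation_number \<nu> a s = real_of_int r"
    using adj by (auto simp: is_adjacency_def rotation_level_set_def)
  then have "\<bar>2 * real_of_int m\<bar> \<le> 1"
    using rotation_number_close[of \<nu> a s] \<open>\<bar>\<nu>\<bar> \<le> 1\<close> m by simp
  then have "m = 0" by linarith
  then show "a = real_of_int r" using m by simp
next
  fix r a s :: real
  assume "is_adjacency \<nu> r (a, s)"
  then obtain k where "trivial_period \<nu> a s k" by (rule adjacency_trivial_period[OF _ assms])
  then show "a \<in> \<int>" by (rule trivial_period_abscissa)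
next
  fix r :: int and a s
  assume "is_adjacency \<nu> (real_of_int r) (a, s)"
  from adjacency_abscissa(3,4)[OF this assms]
  show "sgn a = sgn (real_of_int r)" "\<bar>a\<bar> \<le> \<bar>real_of_int r\<bar>" by simp_all
next
  have "a = 0" if "is_adjacency \<nu> 0 (a, s)" for a s
    using adjacency_abscissa(3)[of \<nu> 0 a s] that assms by simp
  moreover have "r = 0" if adj: "is_adjacency \<nu> r (0, s)" for r s
  proof -
    obtain k where k: "r = real_of_int k" "trivial_period \<nu> 0 s k"
      using adj assms by (rule adjacency_trivial_period)
    from trivial_period_abscissa(4)[OF k(2)] show ?thesis unfolding k(1) by (simp add: sgn_zero_iff)
  qed
  ultimately show "{(a, s). is_adjacency \<nu> 0 (a, s)} =
      {(a, s). (\<exists>r::real. is_adjacency \<nu> r (a, s)) \<and> a = 0}"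
    by (auto simp del: split_paired_Ex)
qed


end
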